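(* Let $\mathcal{P}$ be an arbitrary set of prime numbers (finite or infinite), and let $\langle \mathcal{P} \rangle \subset \mathbb{N}$ denote the set of natural numbers all of whose prime factors lie in $\mathcal{P}$ (including $1$). Then the series $\sum_{n \in \langle \mathcal{P}\rangle} \frac{\mu(n)}{n}$ (summed in increasing order of $n$) converges to $\prod_{p \in \mathcal{P}} (1 - \frac{1}{p})$, i.e. $$\lim_{x \to \infty} \sum_{n \in \langle \mathcal{P} \rangle:\, n \leq x} \frac{\mu(n)}{n} = \prod_{p \in \mathcal{P}} \Big(1-\frac{1}{p}\Big),$$ where the infinite product is interpreted as $0$ when it diverges to zero. In particular, $\sum_{n \in \langle \mathcal{P}\rangle} \frac{\mu(n)}{n}$ converges to $0$ if and only if $\sum_{p \in \mathcal{P}} \frac{1}{p} = \infty$.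
   Context: $\mu$ denotes the Möbius function: $\mu(n) = (-1)^k$ if $n$ is a product of $k$ distinct primes, and $\mu(n)=0$ otherwise. The rate of convergence may depend on $\mathcal{P}$. *)

theory Defs
  imports "HOL-Analysis.Analysis" "HOL-Computational_Algebra.Computational_Algebra"
begin

definition moebius_mu :: "nat \<Rightarrow> real" where
  "moebius_mu n = (if n \<noteq> 0 \<and> squarefree n then (-1) ^ card (prime_factors n) else 0)"

definition generated_by :: "nat set \<Rightarrow> nat set" where
  "generated_by P = {n. n \<ge> 1 \<and> prime_factors n \<subseteq> P}"

end

theory Submission
  imports Defs "HOL-Complex_Analysis.Complex_Analysis"
begin

text \<open>
  Let \<open>P'\<close> be the set of primes outside \<open>P\<close>, and let \<open>S(x)\<close> be the partial sum of \<open>\<mu>(n)/n\<close> over the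
  \<open>n \<in> \<langle>P\<rangle>\<close> up to \<open>x\<close>. If the reciprocals of \<open>P\<close> are summable, everything converges
  absolutely and the limit is the Euler product, which is then positive. Otherwise the product
  is \<open>0\<close>, and there are two cases. If the reciprocals of \<open>P'\<close> are summable, then
  \<open>S(x) = \<Sum>d \<in> \<langle>P'\<rangle>. M(x/d)/d\<close> with \<open>M(y) = \<Sum>n \<le> y. \<mu>(n)/n\<close>; as \<open>M \<rightarrow> 0\<close> (Landau's form of the prime
  number theorem) and \<open>\<Sum>d \<in> \<langle>P'\<rangle>. 1/d\<close> converges, dominated convergence applies. If both diverge,
  then counting the integers up to \<open>x\<close> without prime factors in \<open>P\<close> by the sieve identity shows that
  \<open>x S(x)\<close> is this count plus an error of at most the number of \<open>n \<in> \<langle>P\<rangle>\<close> up to \<open>x\<close>, and both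
  are \<open>o(x)\<close>.

  For \<open>M \<rightarrow> 0\<close> we use Newman's contour argument. The function \<open>z \<zeta>(1 + z)\<close> is
  holomorphic around \<open>Re z \<ge> 0\<close> and has no zero there, so \<open>1/(z \<zeta>(1 + z))\<close> integrates to \<open>0\<close> over
  the closed contour and no winding number of that contour is needed.
\<close>

section \<open>The Moebius function and sieving by primes\<close>

text \<open>The part of \<open>generated_by P\<close> on which \<mu> does not vanish. For a finite
  set of primes it is finite, so Euler products over finite sets become finite sums over it.\<close>

definition squarefree_generated_by :: "nat set \<Rightarrow> nat set" where
  "squarefree_generated_by P = {n \<in> generated_by P. squarefree n}"

lemma moebius_mu_1 [simp]: "moebius_mu 1 = 1" "moebius_mu (Suc 0) = 1"
  by (simp_all add: moebius_mu_def)

lemma abs_moebius_mu_le: "\<bar>moebius_mu n\<bar> \<le> 1"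
  by (simp add: moebius_mu_def power_abs)

lemma squarefree_prime_mult_iff:
  fixes p m :: nat
  assumes "prime p"
  shows "squarefree (p * m) \<longleftrightarrow> squarefree m \<and> \<not> p dvd m"
proof
  assume sq: "squarefree (p * m)"
  have "\<not> p dvd m"
  proof
    assume "p dvd m"
    then have "p\<^sup>2 dvd p * m" by (simp add: power2_eq_square)
    with sq have "p dvd 1" by (rule squarefreeD)
    with assms show False by auto
  qed
  with sq show "squarefree m \<and> \<not> p dvd m" using squarefree_multD by blast
next
  assume "squarefree m \<and> \<not> p dvd m"
  then show "squarefree (p * m)"
    using assms by (meson prime_imp_coprime squarefree_mult_coprime squarefree_prime)
qed

lemma prime_factors_prime_mult:
  fixes p m :: nat
  assumes "prime p" "m \<noteq> 0"
  shows "prime_factors (p * m) = insert p (prime_factors m)"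
  using assms by (simp add: prime_factors_product prime_prime_factors)

lemma moebius_mu_prime_mult:
  assumes "prime p" "\<not> p dvd m"
  shows "moebius_mu (p * m) = - moebius_mu m"
proof (cases "m = 0")
  case False
  have "p \<notin> prime_factors m" using assms(2) by auto
  then show ?thesis using False assms
    by (simp add: moebius_mu_def squarefree_prime_mult_iff prime_factors_prime_mult)
qed (use assms in auto)

lemma squarefree_generated_by_empty: "squarefree_generated_by {} = {1}"
  by (auto simp: squarefree_generated_by_def generated_by_def prime_factorization_empty_iff)

lemma squarefree_generated_by_not_dvd:
  assumes "prime p" "p \<notin> A" "m \<in> squarefree_generated_by A"
  shows "\<not> p dvd m"
  using assms by (auto simp: squarefree_generated_by_def generated_by_def in_prime_factors_iff)

text \<open>A squarefree number contains p at most once, and dividing it out leaves a number over A.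
  This is the induction step both for finiteness and for multiplying out the Euler product.\<close>

lemma squarefree_generated_by_insert:
  assumes p: "prime p" "p \<notin> A"
  shows "squarefree_generated_by (insert p A) =
    squarefree_generated_by A \<union> (*) p ` squarefree_generated_by A"
proof (intro equalityI subsetI)
  fix n assume "n \<in> squarefree_generated_by (insert p A)"
  then have n: "n \<ge> 1" "prime_factors n \<subseteq> insert p A" "squarefree n"
    by (auto simp: squarefree_generated_by_def generated_by_def)
  show "n \<in> squarefree_generated_by A \<union> (*) p ` squarefree_generated_by A"
  proof (cases "p dvd n")
    case True
    then obtain m where m: "n = p * m" by blast
    with n(1) have m0: "m \<noteq> 0" by auto
    have "squarefree m" "\<not> p dvd m"
      using n(3) p(1) unfolding m by (auto simp: squarefree_prime_mult_iff)
    moreover from this have "prime_factors m \<subseteq> A"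
      using n(2) unfolding m using p(1) m0 by (auto simp: prime_factors_prime_mult)
    ultimately have "m \<in> squarefree_generated_by A"
      using m0 by (auto simp: squarefree_generated_by_def generated_by_def)
    with m show ?thesis by blast
  next
    case False
    then have "p \<notin> prime_factors n" by auto
    with n show ?thesis by (auto simp: squarefree_generated_by_def generated_by_def)
  qed
next
  fix n assume "n \<in> squarefree_generated_by A \<union> (*) p ` squarefree_generated_by A"
  then show "n \<in> squarefree_generated_by (insert p A)"
  proof
    assume "n \<in> (*) p ` squarefree_generated_by A"
    then obtain m where m: "n = p * m" "m \<in> squarefree_generated_by A" by blast
    have "\<not> p dvd m" using squarefree_generated_by_not_dvd[OF p m(2)] .
    then show ?thesis using m p
      by (auto simp: squarefree_generated_by_def generated_by_def squarefree_prime_mult_iff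
          prime_factors_prime_mult Suc_le_eq prime_gt_0_nat)
  qed (auto simp: squarefree_generated_by_def generated_by_def)
qed

lemma finite_squarefree_generated_by:
  assumes "finite A" "\<And>p. p \<in> A \<Longrightarrow> prime p"
  shows "finite (squarefree_generated_by A)"
  using assms
  by (induction A rule: finite_induct)
    (simp_all add: squarefree_generated_by_empty squarefree_generated_by_insert)

text \<open>Expanding the product selects a subset of A, that is a squarefree number, with sign
  \<mu>. It is stated for any completely multiplicative f because it is used with the constant 1
  (divisor sums), with 1/n, and with complex powers of n.\<close>

lemma prod_one_minus_eq_sum_moebius_mu:
  fixes f :: "nat \<Rightarrow> 'a :: real_normed_field"
  assumes "finite A" "\<And>p. p \<in> A \<Longrightarrow> prime p"
    and f1: "f 1 = 1" and fm: "\<And>m n. f (m * n) = f m * f n"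
  shows "(\<Prod>p\<in>A. 1 - f p) = (\<Sum>n\<in>squarefree_generated_by A. of_real (moebius_mu n) * f n)"
  using assms(1,2)
proof (induction A rule: finite_induct)
  case empty
  show ?case using f1 by (simp add: squarefree_generated_by_empty)
next
  case (insert p A)
  let ?D = "squarefree_generated_by A" and ?g = "\<lambda>n. of_real (moebius_mu n) * f n"
  have p: "prime p" "p \<notin> A" using insert by auto
  have fin: "finite ?D" using insert by (intro finite_squarefree_generated_by) auto
  have nd: "\<not> p dvd m" if "m \<in> ?D" for m using squarefree_generated_by_not_dvd[OF p that] .
  have inj: "inj_on ((*) p) ?D" using p by (auto simp: inj_on_def)
  have "(\<Sum>n\<in>squarefree_generated_by (insert p A). ?g n)
      = (\<Sum>n\<in>?D. ?g n) + (\<Sum>n\<in>(*) p ` ?D. ?g n)"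
    unfolding squarefree_generated_by_insert[OF p] using fin nd
    by (intro sum.union_disjoint) (auto, metis dvd_triv_left)
  also have "(\<Sum>n\<in>(*) p ` ?D. ?g n) = (\<Sum>n\<in>?D. - f p * ?g n)"
    using p nd by (subst sum.reindex[OF inj])
      (auto intro!: sum.cong simp: moebius_mu_prime_mult fm)
  also have "(\<Sum>n\<in>?D. ?g n) + (\<Sum>n\<in>?D. - f p * ?g n) = (1 - f p) * (\<Sum>n\<in>?D. ?g n)"
    by (simp add: left_diff_distrib sum_negf flip: sum_distrib_left)
  also have "\<dots> = (\<Prod>p\<in>insert p A. 1 - f p)"
    using insert by simp
  finally show ?case by simp
qed

section \<open>Moebius sums over divisors and Legendre's sieve\<close>

lemma squarefree_dvd_of_prime_factors_subset:
  fixes d n :: nat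
  assumes "squarefree d" "n \<noteq> 0" "prime_factors d \<subseteq> prime_factors n"
  shows "d dvd n"
proof (rule multiplicity_le_imp_dvd)
  show "d \<noteq> 0" using assms(1) by (metis not_squarefree_0)
  fix p :: nat assume p: "prime p"
  show "multiplicity p d \<le> multiplicity p n"
  proof (cases "p dvd d")
    case True
    then have "p \<in> prime_factors n"
      using assms p \<open>d \<noteq> 0\<close> by (auto simp: in_prime_factors_iff)
    then have "multiplicity p n \<ge> 1"
      using p assms(2) by (simp add: Suc_le_eq prime_multiplicity_gt_zero_iff prime_factors_dvd)
    moreover have "multiplicity p d \<le> 1"
      using assms(1) p squarefree_factorial_semiring'[of d] by (metis True \<open>d \<noteq> 0\<close> in_prime_factors_iff le_refl)
    ultimately show ?thesis by linarith
  qed (simp add: not_dvd_imp_multiplicity_0)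
qed

text \<open>Only the squarefree numbers composed of the primes common to n and P contribute, so the
  sum is the product of 1 - 1 over these primes; it is 1 exactly when there are none.\<close>

lemma sum_moebius_mu_divisors:
  assumes "n \<noteq> 0"
  shows "(\<Sum>d | d dvd n \<and> d \<in> generated_by P. moebius_mu d) =
    (if prime_factors n \<inter> P = {} then 1 else 0)"
proof -
  let ?A = "prime_factors n \<inter> P"
  have sub: "squarefree_generated_by ?A \<subseteq> {d. d dvd n \<and> d \<in> generated_by P}"
    using assms squarefree_dvd_of_prime_factors_subset
    by (auto simp: squarefree_generated_by_def generated_by_def)
  have "(\<Sum>d | d dvd n \<and> d \<in> generated_by P. moebius_mu d)
      = (\<Sum>d\<in>squarefree_generated_by ?A. moebius_mu d)"
  proof (rule sum.mono_neutral_right[OF _ sub], goal_cases)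
    case 1
    then show ?case using assms by auto
  next
    case 2
    then show ?case using assms
      by (auto simp: squarefree_generated_by_def generated_by_def moebius_mu_def
          dest: dvd_prime_factors[THEN subsetD, rotated 2])
  qed
  also have "\<dots> = (\<Prod>p\<in>?A. 1 - (1::real))"
    using prod_one_minus_eq_sum_moebius_mu[of ?A "\<lambda>_. 1 :: real"]
      in_prime_factors_imp_prime[of _ n] by simp
  also have "\<dots> = (if ?A = {} then 1 else 0)"
    by (simp add: prod_constant card_gt_0_iff)
  finally show ?thesis .
qed

text \<open>Legendre's identity: the indicator of avoiding P is replaced by the preceding divisor
  sum, and after interchanging the sums each d is counted once for each of its X div d
  multiples.\<close>

lemma card_avoiding_primes:
  "real (card {n\<in>{1..X}. prime_factors n \<inter> P = {}}) =
    (\<Sum>d\<in>{1..X} \<inter> generated_by P. moebius_mu d * real (X div d))"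
proof -
  have "real (card {n\<in>{1..X}. prime_factors n \<inter> P = {}})
      = (\<Sum>n=1..X. if prime_factors n \<inter> P = {} then 1 else 0)"
    by (simp add: sum.If_cases Int_def conj_commute)
  also have "\<dots> = (\<Sum>n=1..X. \<Sum>d | d dvd n \<and> d \<in> generated_by P. moebius_mu d)"
    by (intro sum.cong) (auto simp: sum_moebius_mu_divisors)
  also have "\<dots> = (\<Sum>n=1..X. \<Sum>d | d \<in> {1..X} \<inter> generated_by P \<and> d dvd n. moebius_mu d)"
    by (intro sum.cong refl) (auto simp: generated_by_def dest: dvd_imp_le)
  also have "\<dots> = (\<Sum>d\<in>{1..X} \<inter> generated_by P. \<Sum>n | n \<in> {1..X} \<and> d dvd n. moebius_mu d)"
    by (rule sum.swap_restrict) auto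
  also have "\<dots> = (\<Sum>d\<in>{1..X} \<inter> generated_by P. moebius_mu d * real (X div d))"
  proof (intro sum.cong refl)
    fix d assume "d \<in> {1..X} \<inter> generated_by P"
    then have d: "d \<ge> 1" by simp
    have "{n. n \<in> {1..X} \<and> d dvd n} = (*) d ` {1..X div d}"
      using d by (auto simp: less_eq_div_iff_mult_less_eq algebra_simps Suc_le_eq elim!: dvdE)
    moreover have "card ((*) d ` {1..X div d}) = X div d"
      using d by (subst card_image) (auto simp: inj_on_def)
    ultimately show "(\<Sum>n | n \<in> {1..X} \<and> d dvd n. moebius_mu d) = moebius_mu d * real (X div d)"
      by simp
  qed
  finally show ?thesis .
qed

text \<open>Replacing X div d by X/d costs at most 1 for each d, and the main terms add up to X
  times the Euler product. The error does not depend on X.\<close>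

lemma card_avoiding_finite_primes_le:
  assumes "finite A" "\<And>p. p \<in> A \<Longrightarrow> prime p"
  shows "real (card {n\<in>{1..X}. prime_factors n \<inter> A = {}}) \<le>
    real X * (\<Prod>p\<in>A. 1 - 1 / real p) + real (card (squarefree_generated_by A))"
proof -
  let ?D = "squarefree_generated_by A"
  have fin: "finite ?D" using assms by (rule finite_squarefree_generated_by)
  have "real (card {n\<in>{1..X}. prime_factors n \<inter> A = {}})
      = (\<Sum>d\<in>{1..X} \<inter> generated_by A. moebius_mu d * real (X div d))"
    by (rule card_avoiding_primes)
  \<comment> \<open>Terms with d > X may be added since X div d = 0 there, and terms with d not
    squarefree drop out since \<mu> vanishes.\<close>
  also have "\<dots> = (\<Sum>d\<in>?D. moebius_mu d * real (X div d))"
    using fin by (intro sum.mono_neutral_cong)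
      (auto simp: squarefree_generated_by_def generated_by_def moebius_mu_def)
  also have "\<dots> \<le> (\<Sum>d\<in>?D. real X * (moebius_mu d * (1 / real d)) + 1)"
  proof (rule sum_mono)
    fix d assume "d \<in> ?D"
    have "\<bar>real (X div d) - real X / real d\<bar> \<le> 1"
      using floor_correct[of "real X / real d"] unfolding floor_divide_of_nat_eq by simp
    then have "\<bar>moebius_mu d\<bar> * \<bar>real (X div d) - real X / real d\<bar> \<le> 1 * 1"
      using abs_moebius_mu_le[of d] by (intro mult_mono) auto
    then have "\<bar>moebius_mu d * real (X div d) - real X * (moebius_mu d * (1 / real d))\<bar> \<le> 1"
      by (simp add: abs_mult[symmetric] algebra_simps)
    then show "moebius_mu d * real (X div d) \<le> real X * (moebius_mu d * (1 / real d)) + 1"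
      by linarith
  qed
  also have "\<dots> = real X * (\<Sum>d\<in>?D. moebius_mu d * (1 / real d)) + real (card ?D)"
    by (simp add: sum.distrib sum_distrib_left)
  also have "(\<Sum>d\<in>?D. moebius_mu d * (1 / real d)) = (\<Prod>p\<in>A. 1 - 1 / real p)"
    using prod_one_minus_eq_sum_moebius_mu[of A "\<lambda>n. 1 / real n"] assms by simp
  finally show ?thesis .
qed

section \<open>Products of 1 - 1/p compared with sums of 1/p\<close>

lemma prod_one_minus_inverse_le_exp:
  assumes "\<And>p. p \<in> A \<Longrightarrow> prime (p::nat)"
  shows "(\<Prod>p\<in>A. 1 - 1 / real p) \<le> exp (- (\<Sum>p\<in>A. 1 / real p))"
proof (cases "finite A")
  case True
  have "(\<Prod>p\<in>A. 1 - 1 / real p) \<le> (\<Prod>p\<in>A. exp (- (1 / real p)))"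
  proof (intro prod_mono conjI)
    fix p assume "p \<in> A"
    then have "p \<ge> 1" using assms prime_ge_1_nat by blast
    then show "0 \<le> 1 - 1 / real p" by simp
    show "1 - 1 / real p \<le> exp (- (1 / real p))"
      using exp_ge_add_one_self[of "- (1 / real p)"] by simp
  qed
  also have "\<dots> = exp (- (\<Sum>p\<in>A. 1 / real p))"
    using True by (simp add: exp_sum flip: sum_negf)
  finally show ?thesis .
qed simp

text \<open>As p \<ge> 2, the number y = 1/p lies in [0, 1/2], where ln (1 - y) \<ge> - y - 2 y^2
  \<ge> - 2 y. The factor 2 in the exponent comes from this.\<close>

lemma prod_one_minus_inverse_ge_exp:
  assumes "\<And>p. p \<in> A \<Longrightarrow> prime (p::nat)"
  shows "(\<Prod>p\<in>A. 1 - 1 / real p) \<ge> exp (- 2 * (\<Sum>p\<in>A. 1 / real p))"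
proof (cases "finite A")
  case True
  have "exp (- 2 * (\<Sum>p\<in>A. 1 / real p)) = (\<Prod>p\<in>A. exp (- 2 * (1 / real p)))"
    using True by (simp add: exp_sum sum_distrib_left flip: sum_negf)
  also have "\<dots> \<le> (\<Prod>p\<in>A. 1 - 1 / real p)"
  proof (intro prod_mono conjI)
    fix p assume "p \<in> A"
    then have p: "p \<ge> 2" using assms prime_ge_2_nat by blast
    define y where "y = 1 / real p"
    have y: "0 \<le> y" "y \<le> 1 / 2" using p by (auto simp: y_def field_simps)
    have "y * y \<le> y * (1 / 2)" using y by (intro mult_left_mono)
    then have "- 2 * y \<le> - y - 2 * y\<^sup>2" by (simp add: power2_eq_square)
    also have "\<dots> \<le> ln (1 - y)" using y by (rule ln_one_minus_pos_lower_bound)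
    finally have "exp (- 2 * y) \<le> exp (ln (1 - y))" by simp
    then show "exp (- 2 * (1 / real p)) \<le> 1 - 1 / real p"
      using y unfolding y_def by (subst (asm) exp_ln) auto
  qed simp
  finally show ?thesis .
qed simp

lemma sum_inverse_primes_unbounded:
  assumes "\<not> summable (\<lambda>p::nat. if p \<in> Q then 1 / real p else 0)"
  obtains A where "finite A" "A \<subseteq> Q" "(\<Sum>p\<in>A. 1 / real p) > K"
proof -
  have "\<exists>n. (\<Sum>p<n. if p \<in> Q then 1 / real p else 0) > K"
  proof (rule ccontr)
    assume "\<not> ?thesis"
    then have "summable (\<lambda>p::nat. if p \<in> Q then 1 / real p else 0)"
      by (intro summableI_nonneg_bounded[where x = K]) (auto simp: not_less)
    with assms show False by contradiction
  qed
  then obtain n where n: "(\<Sum>p<n. if p \<in> Q then 1 / real p else 0) > K" by blast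
  have "(\<Sum>p<n. if p \<in> Q then 1 / real p else 0) = (\<Sum>p\<in>{..<n} \<inter> Q. 1 / real p)"
    by (simp add: sum.inter_restrict)
  with n show ?thesis by (intro that[of "{..<n} \<inter> Q"]) auto
qed

text \<open>The bound is given for all finite B between A and Q: the density estimate takes B = A,
  the limit of the partial products takes B = Q \<inter> {..X}.\<close>

lemma prod_one_minus_inverse_small:
  assumes "\<not> summable (\<lambda>p::nat. if p \<in> Q then 1 / real p else 0)"
    and "\<And>p. p \<in> Q \<Longrightarrow> prime p" and "\<epsilon> > 0"
  obtains A where "finite A" "A \<subseteq> Q"
    "\<And>B. finite B \<Longrightarrow> A \<subseteq> B \<Longrightarrow> B \<subseteq> Q \<Longrightarrow> (\<Prod>p\<in>B. 1 - 1 / real p) < \<epsilon>"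
proof -
  obtain A where A: "finite A" "A \<subseteq> Q" "(\<Sum>p\<in>A. 1 / real p) > - ln \<epsilon>"
    using sum_inverse_primes_unbounded[OF assms(1)] by metis
  show ?thesis
  proof (rule that[OF A(1,2)])
    fix B assume B: "finite B" "A \<subseteq> B" "B \<subseteq> Q"
    have "(\<Prod>p\<in>B. 1 - 1 / real p) \<le> exp (- (\<Sum>p\<in>B. 1 / real p))"
      using B assms(2) by (intro prod_one_minus_inverse_le_exp) auto
    also have "(\<Sum>p\<in>A. 1 / real p) \<le> (\<Sum>p\<in>B. 1 / real p)"
      using B by (intro sum_mono2) auto
    with A(3) have "exp (- (\<Sum>p\<in>B. 1 / real p)) < exp (ln \<epsilon>)" by simp
    also have "\<dots> = \<epsilon>" using assms(3) by simp
    finally show "(\<Prod>p\<in>B. 1 - 1 / real p) < \<epsilon>" .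
  qed
qed

lemma prod_one_minus_inverse_nonneg:
  assumes "\<And>p. p \<in> A \<Longrightarrow> prime (p::nat)"
  shows "(\<Prod>p\<in>A. 1 - 1 / real p) \<ge> 0"
proof (rule prod_nonneg)
  fix p assume "p \<in> A"
  then have "p \<ge> 1" using assms prime_ge_1_nat by blast
  then show "0 \<le> 1 - 1 / real p" by simp
qed

lemma prod_one_minus_inverse_tendsto_0:
  assumes "\<not> summable (\<lambda>p::nat. if p \<in> Q then 1 / real p else 0)"
    and "\<And>p. p \<in> Q \<Longrightarrow> prime p"
  shows "(\<lambda>X. \<Prod>p\<in>Q \<inter> {..X}. 1 - 1 / real p) \<longlonglongrightarrow> 0"
proof (rule LIMSEQ_I)
  fix \<epsilon> :: real assume "\<epsilon> > 0"
  then obtain A where A: "finite A" "A \<subseteq> Q"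
    "\<And>B. finite B \<Longrightarrow> A \<subseteq> B \<Longrightarrow> B \<subseteq> Q \<Longrightarrow> (\<Prod>p\<in>B. 1 - 1 / real p) < \<epsilon>"
    using prod_one_minus_inverse_small[OF assms] by metis
  obtain N where N: "A \<subseteq> {..N}"
    using A(1) finite_nat_iff_bounded_le by blast
  have "norm ((\<Prod>p\<in>Q \<inter> {..X}. 1 - 1 / real p) - 0) < \<epsilon>" if "X \<ge> N" for X
  proof -
    have "(\<Prod>p\<in>Q \<inter> {..X}. 1 - 1 / real p) \<ge> 0"
      using assms(2) by (intro prod_one_minus_inverse_nonneg) auto
    moreover have "(\<Prod>p\<in>Q \<inter> {..X}. 1 - 1 / real p) < \<epsilon>"
      using A(2) N that by (intro A(3)) auto
    ultimately show ?thesis by simp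
  qed
  then show "\<exists>no. \<forall>n\<ge>no. norm ((\<Prod>p\<in>Q \<inter> {..n}. 1 - 1 / real p) - 0) < \<epsilon>" by blast
qed

text \<open>Avoiding Q implies avoiding any finite A \<subseteq> Q. First A is chosen with Euler
  product below \<epsilon>/2 and then kept fixed, so that the error of the sieve is a constant that
  is negligible against X.\<close>

lemma avoiding_primes_density_0:
  assumes "\<not> summable (\<lambda>p::nat. if p \<in> Q then 1 / real p else 0)"
    and "\<And>p. p \<in> Q \<Longrightarrow> prime p"
  shows "(\<lambda>X. real (card {n\<in>{1..X}. prime_factors n \<inter> Q = {}}) / real X) \<longlonglongrightarrow> 0"
proof (rule tendstoI)
  fix \<epsilon> :: real assume \<epsilon>: "\<epsilon> > 0"
  then obtain A where A: "finite A" "A \<subseteq> Q"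
    "\<And>B. finite B \<Longrightarrow> A \<subseteq> B \<Longrightarrow> B \<subseteq> Q \<Longrightarrow> (\<Prod>p\<in>B. 1 - 1 / real p) < \<epsilon> / 2"
    using prod_one_minus_inverse_small[OF assms, of "\<epsilon> / 2"] by (metis half_gt_zero)
  define c where "c = real (card (squarefree_generated_by A))"
  have small: "(\<Prod>p\<in>A. 1 - 1 / real p) < \<epsilon> / 2" using A by blast
  have "(\<lambda>X::nat. c / real X) \<longlonglongrightarrow> 0" by (rule lim_const_over_n)
  then have "eventually (\<lambda>X. c / real X < \<epsilon> / 2) sequentially"
    using \<epsilon> by (intro order_tendstoD(2)[of _ 0]) auto
  then show "eventually (\<lambda>X. dist (real (card {n\<in>{1..X}. prime_factors n \<inter> Q = {}}) / real X) 0 < \<epsilon>) sequentially"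
    using eventually_gt_at_top[of 0]
  proof eventually_elim
    case (elim X)
    have "card {n\<in>{1..X}. prime_factors n \<inter> Q = {}} \<le> card {n\<in>{1..X}. prime_factors n \<inter> A = {}}"
      using A(2) by (intro card_mono) auto
    moreover have "real (card {n\<in>{1..X}. prime_factors n \<inter> A = {}}) \<le> real X * (\<Prod>p\<in>A. 1 - 1 / real p) + c"
      unfolding c_def using A(1,2) assms(2) by (intro card_avoiding_finite_primes_le) auto
    ultimately have "real (card {n\<in>{1..X}. prime_factors n \<inter> Q = {}}) \<le> real X * (\<Prod>p\<in>A. 1 - 1 / real p) + c"
      by linarith
    then have "real (card {n\<in>{1..X}. prime_factors n \<inter> Q = {}}) / real X \<le> (\<Prod>p\<in>A. 1 - 1 / real p) + c / real X"
      using elim by (simp add: field_simps)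
    also have "\<dots> < \<epsilon>" using small elim(1) by linarith
    finally show ?case by simp
  qed
qed

text \<open>A number over insert p A is either free of p or p times another such number, which gives
  H \<le> G + H/p for the sums H and G over the new and the old set. Cutting off at X keeps all sums
  finite, so H/p can be moved to the left.\<close>

lemma sum_inverse_generated_by_finite_le:
  assumes "finite A" "\<And>p. p \<in> A \<Longrightarrow> prime p"
  shows "(\<Sum>n\<in>generated_by A \<inter> {..X}. 1 / real n) * (\<Prod>p\<in>A. 1 - 1 / real p) \<le> 1"
  using assms
proof (induction A rule: finite_induct)
  case empty
  have "generated_by {} \<inter> {..X} \<subseteq> {1}"
    by (auto simp: generated_by_def prime_factorization_empty_iff)
  then have "(\<Sum>n\<in>generated_by {} \<inter> {..X}. 1 / real n) \<le> (\<Sum>n\<in>{1}. 1 / real n)"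
    by (intro sum_mono2) auto
  then show ?case by simp
next
  case (insert p A)
  let ?G = "generated_by A \<inter> {..X}" and ?H = "generated_by (insert p A) \<inter> {..X}"
  have p: "prime p" using insert by simp
  have sub: "?H \<subseteq> ?G \<union> (*) p ` ?H"
  proof
    fix n assume n: "n \<in> ?H"
    show "n \<in> ?G \<union> (*) p ` ?H"
    proof (cases "p dvd n")
      case True
      then obtain m where m: "n = p * m" by blast
      have "m \<noteq> 0" using n m by (auto simp: generated_by_def)
      moreover have "m \<le> n" using m p prime_gt_0_nat[of p] by (cases p) auto
      moreover have "prime_factors m \<subseteq> prime_factors n"
        using m p \<open>m \<noteq> 0\<close> by (auto simp: prime_factors_prime_mult)
      ultimately have "m \<in> ?H" using n by (auto simp: generated_by_def)
      with m show ?thesis by blast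
    next
      case False
      then have "p \<notin> prime_factors n" by auto
      with n show ?thesis by (auto simp: generated_by_def)
    qed
  qed
  have "(\<Sum>n\<in>?H. 1 / real n) \<le> (\<Sum>n\<in>?G \<union> (*) p ` ?H. 1 / real n)"
    using sub by (intro sum_mono2) auto
  also have "\<dots> \<le> (\<Sum>n\<in>?G. 1 / real n) + (\<Sum>n\<in>(*) p ` ?H. 1 / real n)"
    by (subst sum_Un) (auto intro!: sum_nonneg)
  also have "(\<Sum>n\<in>(*) p ` ?H. 1 / real n) = (1 / real p) * (\<Sum>n\<in>?H. 1 / real n)"
    using p prime_gt_0_nat[of p] by (subst sum.reindex) (auto simp: inj_on_def sum_distrib_left)
  finally have "(\<Sum>n\<in>?H. 1 / real n) * (1 - 1 / real p) \<le> (\<Sum>n\<in>?G. 1 / real n)"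
    by (simp add: algebra_simps)
  then have "(\<Sum>n\<in>?H. 1 / real n) * (1 - 1 / real p) * (\<Prod>p\<in>A. 1 - 1 / real p)
      \<le> (\<Sum>n\<in>?G. 1 / real n) * (\<Prod>p\<in>A. 1 - 1 / real p)"
    using insert.prems by (intro mult_right_mono prod_one_minus_inverse_nonneg) auto
  also have "\<dots> \<le> 1" using insert by simp
  finally show ?case using insert.hyps by (simp add: mult.assoc)
qed

section \<open>Absolute convergence when the reciprocals of the primes are summable\<close>

lemma sum_inverse_le_suminf:
  assumes "summable (\<lambda>p::nat. if p \<in> P then 1 / real p else 0)" "finite A" "A \<subseteq> P"
  shows "(\<Sum>p\<in>A. 1 / real p) \<le> (\<Sum>p. if p \<in> P then 1 / real p else 0)"
proof -
  have "(\<Sum>p\<in>A. 1 / real p) = (\<Sum>p\<in>A. if p \<in> P then 1 / real p else 0)"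
    using assms(3) by (intro sum.cong) auto
  also have "\<dots> \<le> (\<Sum>p. if p \<in> P then 1 / real p else 0)"
    using assms by (intro sum_le_suminf) auto
  finally show ?thesis .
qed

text \<open>A partial sum below X involves only primes up to X, and the product over these is at
  least exp (-2K) with K the full sum of reciprocals. Hence every partial sum is at most exp
  (2K).\<close>

lemma summable_inverse_generated_by:
  assumes "summable (\<lambda>p::nat. if p \<in> P then 1 / real p else 0)"
    and "\<And>p. p \<in> P \<Longrightarrow> prime p"
  shows "summable (\<lambda>n. if n \<in> generated_by P then 1 / real n else 0)"
proof (rule summableI_nonneg_bounded)
  define K where "K = (\<Sum>p. if p \<in> P then 1 / real p else 0)"
  fix X :: nat
  let ?A = "P \<inter> {..X}" and ?S = "(\<Sum>n<X. if n \<in> generated_by P then 1 / real n else 0)"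
  have "?S = (\<Sum>n\<in>{..<X} \<inter> generated_by P. 1 / real n)"
    by (simp add: sum.inter_restrict)
  also have "\<dots> \<le> (\<Sum>n\<in>generated_by ?A \<inter> {..X}. 1 / real n)"
    by (intro sum_mono2) (auto simp: generated_by_def dest!: in_prime_factors_imp_dvd dvd_imp_le)
  finally have "?S \<le> (\<Sum>n\<in>generated_by ?A \<inter> {..X}. 1 / real n)" .
  moreover have "exp (- 2 * K) \<le> (\<Prod>p\<in>?A. 1 - 1 / real p)"
  proof -
    have "exp (- 2 * K) \<le> exp (- 2 * (\<Sum>p\<in>?A. 1 / real p))"
      using sum_inverse_le_suminf[OF assms(1), of ?A] by (simp add: K_def)
    also have "\<dots> \<le> (\<Prod>p\<in>?A. 1 - 1 / real p)"
      using assms(2) by (intro prod_one_minus_inverse_ge_exp) auto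
    finally show ?thesis .
  qed
  ultimately have "?S * exp (- 2 * K) \<le>
      (\<Sum>n\<in>generated_by ?A \<inter> {..X}. 1 / real n) * (\<Prod>p\<in>?A. 1 - 1 / real p)"
    by (intro mult_mono) (auto intro!: sum_nonneg)
  also have "\<dots> \<le> 1" using assms(2) by (intro sum_inverse_generated_by_finite_le) auto
  finally have "?S * exp (- 2 * K) * exp (2 * K) \<le> 1 * exp (2 * K)"
    by (intro mult_right_mono) auto
  then show "?S \<le> exp (2 * K)" by (simp add: mult.assoc flip: exp_add)
qed auto

text \<open>The product over primes up to X is the sum of \<open>a\<close> over the finite set
  \<open>?D X\<close>. These sets are not initial segments of the naturals, but they exhaust the
  support of \<open>a\<close>, so absolute convergence, used in the unordered form
  \<open>has_sum\<close>, gives the limit.\<close>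

lemma moebius_mu_euler_product:
  fixes f :: "nat \<Rightarrow> 'a :: {real_normed_field, banach}"
  assumes "\<And>p. p \<in> P \<Longrightarrow> prime p"
    and f1: "f 1 = 1" and fm: "\<And>m n. f (m * n) = f m * f n"
    and summ: "summable (\<lambda>n. if n \<in> generated_by P then norm (f n) else 0)"
  defines "a \<equiv> \<lambda>n. if n \<in> generated_by P then of_real (moebius_mu n) * f n else 0"
  shows "summable (\<lambda>n. norm (a n))"
    and "(\<lambda>X. \<Prod>p\<in>P \<inter> {..X}. 1 - f p) \<longlonglongrightarrow> suminf a"
proof -
  show summ_a: "summable (\<lambda>n. norm (a n))"
  proof (rule summable_comparison_test[OF _ summ], intro exI allI impI)
    fix n :: nat
    show "norm (norm (a n)) \<le> (if n \<in> generated_by P then norm (f n) else 0)"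
      using abs_moebius_mu_le[of n] by (auto simp: a_def norm_mult intro!: mult_left_le_one_le)
  qed
  let ?W = "squarefree_generated_by P" and ?D = "\<lambda>X. squarefree_generated_by (P \<inter> {..X})"
  have a0: "a n = 0" if "n \<notin> ?W" for n
    using that by (auto simp: a_def squarefree_generated_by_def moebius_mu_def)
  have "(a has_sum suminf a) UNIV"
    by (rule norm_summable_imp_has_sum[OF summ_a summable_sums[OF summable_norm_cancel[OF summ_a]]])
  then have "(a has_sum suminf a) ?W"
    by (subst has_sum_cong_neutral[where T = UNIV and g = a]) (auto simp: a0)
  then have "((\<lambda>F. sum a F) \<longlongrightarrow> suminf a) (finite_subsets_at_top ?W)"
    by (simp add: has_sum_def)
  moreover have "filterlim ?D (finite_subsets_at_top ?W) sequentially"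
    unfolding filterlim_finite_subsets_at_top
  proof (intro allI impI)
    fix Y assume Y: "finite Y \<and> Y \<subseteq> ?W"
    then obtain N where N: "Y \<subseteq> {..N}" using finite_nat_iff_bounded_le by blast
    show "eventually (\<lambda>X. finite (?D X) \<and> Y \<subseteq> ?D X \<and> ?D X \<subseteq> ?W) sequentially"
      using eventually_ge_at_top[of N]
    proof eventually_elim
      case (elim X)
      have "finite (?D X)" using assms(1) by (intro finite_squarefree_generated_by) auto
      moreover have "Y \<subseteq> ?D X"
      proof
        fix n assume "n \<in> Y"
        then have "n \<in> ?W" "n \<le> X" using Y N elim by auto
        moreover have "p \<le> n" if "p \<in> prime_factors n" for p
          using that \<open>n \<in> ?W\<close> by (intro dvd_imp_le) (auto simp: squarefree_generated_by_def generated_by_def)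
        ultimately show "n \<in> ?D X"
          by (fastforce simp: squarefree_generated_by_def generated_by_def)
      qed
      moreover have "?D X \<subseteq> ?W" by (auto simp: squarefree_generated_by_def generated_by_def)
      ultimately show ?case by blast
    qed
  qed
  ultimately have "(\<lambda>X. sum a (?D X)) \<longlonglongrightarrow> suminf a"
    by (rule filterlim_compose)
  moreover have "sum a (?D X) = (\<Prod>p\<in>P \<inter> {..X}. 1 - f p)" for X
  proof -
    have "sum a (?D X) = (\<Sum>n\<in>?D X. of_real (moebius_mu n) * f n)"
      by (intro sum.cong) (auto simp: a_def squarefree_generated_by_def generated_by_def)
    also have "\<dots> = (\<Prod>p\<in>P \<inter> {..X}. 1 - f p)"
      using assms(1) by (intro prod_one_minus_eq_sum_moebius_mu[symmetric] f1 fm) auto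
    finally show ?thesis .
  qed
  ultimately show "(\<lambda>X. \<Prod>p\<in>P \<inter> {..X}. 1 - f p) \<longlonglongrightarrow> suminf a" by simp
qed

section \<open>Non-vanishing of zeta on the line of real part one\<close>

lemma norm_of_nat_powr: "norm (of_nat n powr s :: complex) = real n powr Re s"
  by (cases "n = 0") (auto simp: norm_powr_real_powr)

lemma of_nat_mult_powr:
  "of_nat (m * n) powr s = (of_nat m powr s * of_nat n powr s :: complex)"
  by (simp add: powr_times_real)

lemma summable_norm_of_nat_powr:
  assumes "Re s > 1"
  shows "summable (\<lambda>n. norm (of_nat n powr (-s) :: complex))"
  using assms by (simp add: norm_of_nat_powr summable_real_powr_iff)

text \<open>For Re s > 1 this is the Riemann zeta function. The term n = 0 is harmless because 0
  powr anything is 0.\<close>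

definition zeta_series :: "complex \<Rightarrow> complex" where
  "zeta_series s = (\<Sum>n. of_nat n powr (-s))"

definition moebius_series :: "complex \<Rightarrow> complex" where
  "moebius_series s = (\<Sum>n. of_real (moebius_mu n) * of_nat n powr (-s))"

text \<open>The sieve of Eratosthenes: multiplying by the factor of p subtracts the terms at the
  multiples of p that are still present.\<close>

lemma zeta_series_sieve:
  assumes s: "Re s > 1" and "finite A" "\<And>p. p \<in> A \<Longrightarrow> prime p"
  shows "((\<lambda>n. of_nat n powr (-s)) has_sum (zeta_series s * (\<Prod>p\<in>A. 1 - of_nat p powr (-s))))
    {n. n \<ge> 1 \<and> prime_factors n \<inter> A = {}}"
  using assms(2,3)
proof (induction A rule: finite_induct)
  case empty
  have "((\<lambda>n. of_nat n powr (-s)) has_sum zeta_series s) UNIV"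
    unfolding zeta_series_def using summable_norm_of_nat_powr[OF s]
    by (intro norm_summable_imp_has_sum summable_sums) (auto intro: summable_norm_cancel)
  then show ?case
    by (subst has_sum_cong_neutral[where T = UNIV and g = "\<lambda>n. of_nat n powr (-s)"])
      (auto simp: Suc_le_eq)
next
  case (insert p A)
  let ?g = "\<lambda>n. of_nat n powr (-s) :: complex"
  let ?U = "\<lambda>A. {n::nat. n \<ge> 1 \<and> prime_factors n \<inter> A = {}}"
  let ?S = "zeta_series s * (\<Prod>p\<in>A. 1 - ?g p)"
  have p: "prime p" "p \<notin> A" using insert by auto
  have p0: "p > 0" using p prime_gt_0_nat by blast
  have IH: "(?g has_sum ?S) (?U A)" using insert by simp
  have img: "(?g has_sum (?g p * ?S)) ((*) p ` ?U A)"
  proof (subst has_sum_reindex)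
    show "inj_on ((*) p) (?U A)" using p0 by (auto simp: inj_on_def)
    have "?g \<circ> (*) p = (\<lambda>n. ?g p * ?g n)"
      by (simp add: fun_eq_iff powr_times_real)
    then show "(?g \<circ> (*) p has_sum ?g p * ?S) (?U A)"
      using has_sum_cmult_right[OF IH] by simp
  qed
  have sub: "(*) p ` ?U A \<subseteq> ?U A"
    using p p0 by (auto simp: prime_factors_prime_mult Suc_le_eq)
  have "?U (insert p A) = ?U A - (*) p ` ?U A"
  proof (intro equalityI subsetI)
    fix n assume n: "n \<in> ?U (insert p A)"
    then have "\<not> p dvd n" using p by (auto simp: in_prime_factors_iff)
    with n show "n \<in> ?U A - (*) p ` ?U A" by auto
  next
    fix n assume n: "n \<in> ?U A - (*) p ` ?U A"
    have "\<not> p dvd n"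
    proof
      assume "p dvd n"
      then obtain m where m: "n = p * m" by blast
      then have "m \<noteq> 0" using n by auto
      moreover have "prime_factors m \<subseteq> prime_factors n"
        using m p \<open>m \<noteq> 0\<close> by (auto simp: prime_factors_prime_mult)
      ultimately have "m \<in> ?U A" using n by auto
      with m n show False by blast
    qed
    then show "n \<in> ?U (insert p A)" using n by auto
  qed
  moreover have "(?g has_sum (?S - ?g p * ?S)) (?U A - (*) p ` ?U A)"
    by (rule has_sum_Diff[OF IH img sub])
  moreover have "?S - ?g p * ?S = zeta_series s * (\<Prod>p\<in>insert p A. 1 - ?g p)"
    using insert.hyps by (simp add: algebra_simps)
  ultimately show ?case by simp
qed

text \<open>After sieving by the primes up to X only 1 and numbers all of whose prime factors exceed
  X survive. Each fixed n > 1 is therefore eventually removed, and Tannery's theorem with the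
  absolutely convergent zeta series as majorant leaves only the term 1.\<close>

lemma zeta_series_times_euler_product:
  assumes s: "Re s > 1"
  shows "(\<lambda>X. zeta_series s * (\<Prod>p\<in>{p. prime p} \<inter> {..X}. 1 - of_nat p powr (-s))) \<longlonglongrightarrow> 1"
proof -
  let ?g = "\<lambda>n. of_nat n powr (-s) :: complex"
  define U where "U X = {n::nat. n \<ge> 1 \<and> prime_factors n \<inter> ({p. prime p} \<inter> {..X}) = {}}" for X :: nat
  define a where "a n X = (if n \<in> U X then ?g n else 0)" for n X
  have lim: "(\<lambda>X. a n X) \<longlonglongrightarrow> (if n = 1 then 1 else 0)" for n
  proof (rule tendsto_eventually)
    show "eventually (\<lambda>X. a n X = (if n = 1 then 1 else 0)) sequentially"
      using eventually_ge_at_top[of n]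
    proof eventually_elim
      case (elim X)
      show ?case
      proof (cases "n \<ge> 2")
        case True
        then obtain p where p: "prime p" "p dvd n" using prime_factor_nat[of n] by auto
        then have "p \<in> prime_factors n" "p \<le> X"
          using True elim by (auto simp: in_prime_factors_iff dest: dvd_imp_le)
        then have "n \<notin> U X" using p by (auto simp: U_def)
        then show ?thesis using True by (simp add: a_def)
      next
        case False
        then consider "n = 0" | "n = 1" by linarith
        then show ?thesis by cases (auto simp: a_def U_def)
      qed
    qed
  qed
  have bnd: "eventually (\<lambda>(n, X). norm (a n X) \<le> norm (?g n)) (sequentially \<times>\<^sub>F sequentially)"
    by (intro always_eventually) (auto simp: a_def)
  have "(\<lambda>X. \<Sum>n. a n X) \<longlonglongrightarrow> (\<Sum>n::nat. if n = 1 then 1 else 0)"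
    using tannerys_theorem[OF lim bnd summable_norm_of_nat_powr[OF s] sequentially_bot] by blast
  moreover have "(\<Sum>n::nat. if n = 1 then 1 else 0 :: complex) = 1"
    using suminf_finite[of "{1}" "\<lambda>n::nat. if n = 1 then 1 else 0 :: complex"] by simp
  moreover have "(\<Sum>n. a n X) = zeta_series s * (\<Prod>p\<in>{p. prime p} \<inter> {..X}. 1 - ?g p)" for X
  proof -
    have "(?g has_sum (zeta_series s * (\<Prod>p\<in>{p. prime p} \<inter> {..X}. 1 - ?g p))) (U X)"
      unfolding U_def using s by (intro zeta_series_sieve) auto
    then have "((\<lambda>n. a n X) has_sum (zeta_series s * (\<Prod>p\<in>{p. prime p} \<inter> {..X}. 1 - ?g p))) UNIV"
      by (subst has_sum_cong_neutral[where T = "U X" and g = ?g]) (auto simp: a_def)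
    then show ?thesis by (metis has_sum_imp_sums sums_unique)
  qed
  ultimately show ?thesis by simp
qed

lemma
  assumes s: "Re s > 1"
  shows summable_moebius_series: "summable (\<lambda>n. norm (of_real (moebius_mu n) * of_nat n powr (-s)))"
    and moebius_series_euler_product:
      "(\<lambda>X. \<Prod>p\<in>{p. prime p} \<inter> {..X}. 1 - of_nat p powr (-s)) \<longlonglongrightarrow> moebius_series s"
proof -
  let ?g = "\<lambda>n. of_nat n powr (-s) :: complex"
  have gen: "n \<in> generated_by {p. prime p} \<longleftrightarrow> n \<noteq> 0" for n
    by (auto simp: generated_by_def)
  have eq1: "(\<lambda>n. if n \<in> generated_by {p. prime p} then norm (?g n) else 0) = (\<lambda>n. norm (?g n))"
    by (auto simp: gen fun_eq_iff)
  have eq2: "(\<lambda>n. if n \<in> generated_by {p. prime p} then of_real (moebius_mu n) * ?g n else 0)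
      = (\<lambda>n. of_real (moebius_mu n) * ?g n)"
    by (auto simp: gen fun_eq_iff)
  have summ: "summable (\<lambda>n. if n \<in> generated_by {p. prime p} then norm (?g n) else 0)"
    unfolding eq1 by (rule summable_norm_of_nat_powr[OF s])
  note E = moebius_mu_euler_product[of "{p. prime p}" ?g, OF _ _ of_nat_mult_powr summ, unfolded fun_cong[OF eq2] eq2]
  show "summable (\<lambda>n. norm (of_real (moebius_mu n) * ?g n))"
    by (rule E) auto
  show "(\<lambda>X. \<Prod>p\<in>{p. prime p} \<inter> {..X}. 1 - ?g p) \<longlonglongrightarrow> moebius_series s"
    unfolding moebius_series_def by (rule E) auto
qed

text \<open>The partial Euler products tend to \<open>moebius_series s\<close>, and zeta times the
  same products tends to 1. In particular zeta has no zero with real part above one.\<close>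

lemma zeta_series_times_moebius_series:
  assumes "Re s > 1"
  shows "zeta_series s * moebius_series s = 1"
  by (rule LIMSEQ_unique[OF tendsto_mult_left[OF moebius_series_euler_product[OF assms]]
      zeta_series_times_euler_product[OF assms]])

text \<open>\<open>3 + 4 cos \<theta> + cos 2\<theta> = 2 (1 + cos \<theta>)\<^sup>2 \<ge> 0\<close>, applied to each term of the logarithmic series.\<close>

lemma three_four_one_local:
  fixes r :: real and w :: complex
  assumes r: "0 \<le> r" "r < 1" and w: "norm w = 1"
  shows "norm (1 - of_real r :: complex) ^ 3 * norm (1 - of_real r * w) ^ 4 * norm (1 - of_real r * w\<^sup>2) \<le> 1"
proof -
  have log: "(\<lambda>n. - (Re (z ^ n) / real n)) sums ln (norm (1 - z)) \<and> norm (1 - z) > 0"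
    if z: "norm z < 1" for z :: complex
  proof -
    have nz: "1 - z \<noteq> 0" using z by auto
    have "(\<lambda>n. - (z ^ n / of_nat n)) sums ln (1 - z)" using Ln_series'[of "- z"] z by simp
    then have "(\<lambda>n. Re (- (z ^ n / of_nat n))) sums Re (ln (1 - z))" by (rule sums_Re)
    then show ?thesis using nz by simp
  qed
  let ?z = "\<lambda>j. of_real r * w ^ j :: complex"
  have z: "norm (?z j) < 1" for j using r w by (simp add: norm_mult norm_power)
  define T where "T = (\<lambda>n. 3 * - (Re (?z 0 ^ n) / real n) + 4 * - (Re (?z 1 ^ n) / real n) + - (Re (?z 2 ^ n) / real n))"
  have "T sums (3 * ln (norm (1 - ?z 0)) + 4 * ln (norm (1 - ?z 1)) + ln (norm (1 - ?z 2)))"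
    unfolding T_def by (intro sums_add sums_mult conjunct1[OF log[OF z]])
  moreover have "T n \<le> 0" for n
  proof -
    define c where "c = Re (w ^ n)"
    have "norm (w ^ n) = 1" using w by (simp add: norm_power)
    then have "(Re (w ^ n))\<^sup>2 + (Im (w ^ n))\<^sup>2 = 1" by (simp add: cmod_def)
    then have "Re ((w ^ n)\<^sup>2) = 2 * c\<^sup>2 - 1" by (simp add: c_def power2_eq_square)
    moreover have "(w\<^sup>2) ^ n = (w ^ n)\<^sup>2" by (simp add: mult.commute flip: power_mult)
    ultimately have "Re ((w\<^sup>2) ^ n) = 2 * c\<^sup>2 - 1" by simp
    then have "3 + 4 * c + Re ((w\<^sup>2) ^ n) = 2 * (1 + c)\<^sup>2"
      by (simp add: power2_eq_square algebra_simps)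
    moreover have "T n = - ((r ^ n / real n) * (3 + 4 * c + Re ((w\<^sup>2) ^ n)))"
      by (simp add: T_def power_mult_distrib c_def ring_distribs mult_ac flip: of_real_power)
    ultimately have "T n = - ((r ^ n / real n) * (2 * (1 + c)\<^sup>2))" by simp
    also have "\<dots> \<le> 0" using r by simp
    finally show ?thesis .
  qed
  ultimately have "3 * ln (norm (1 - ?z 0)) + 4 * ln (norm (1 - ?z 1)) + ln (norm (1 - ?z 2)) \<le> 0"
    by (rule sums_le[OF _ _ sums_zero, rotated])
  also have "3 * ln (norm (1 - ?z 0)) + 4 * ln (norm (1 - ?z 1)) + ln (norm (1 - ?z 2))
      = ln (norm (1 - ?z 0) ^ 3 * norm (1 - ?z 1) ^ 4 * norm (1 - ?z 2))"
    using log[OF z[of 0]] log[OF z[of 1]] log[OF z[of 2]]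
    by (simp add: ln_mult ln_realpow)
  finally show ?thesis
    using log[OF z[of 0]] log[OF z[of 1]] log[OF z[of 2]] by simp
qed

text \<open>The local inequality is multiplied over the primes up to X and carried to the limit,
  where it bounds the values of the Moebius series from above; since these are the inverses of the
  zeta values, the bound turns round.\<close>

lemma three_four_one:
  fixes \<sigma> t :: real
  assumes \<sigma>: "\<sigma> > 1"
  shows "1 \<le> norm (zeta_series (of_real \<sigma>)) ^ 3 * norm (zeta_series (Complex \<sigma> t)) ^ 4
    * norm (zeta_series (Complex \<sigma> (2 * t)))"
proof -
  let ?E = "\<lambda>s X. \<Prod>p\<in>{p. prime p} \<inter> {..X}. 1 - of_nat p powr (-s) :: complex"
  let ?s = "\<lambda>j. Complex \<sigma> (j * t)"
  let ?\<mu> = "\<lambda>j. norm (moebius_series (?s j))" and ?\<zeta> = "\<lambda>j. norm (zeta_series (?s j))"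
  have le: "norm (?E (?s 0) X) ^ 3 * norm (?E (?s 1) X) ^ 4 * norm (?E (?s 2) X) \<le> 1" for X
  proof -
    have "norm (?E (?s 0) X) ^ 3 * norm (?E (?s 1) X) ^ 4 * norm (?E (?s 2) X) =
        (\<Prod>p\<in>{p. prime p} \<inter> {..X}. norm (1 - of_nat p powr (- ?s 0) :: complex) ^ 3
          * norm (1 - of_nat p powr (- ?s 1) :: complex) ^ 4 * norm (1 - of_nat p powr (- ?s 2) :: complex))"
      by (simp add: prod_norm[symmetric] prod.distrib prod_power_distrib)
    also have "\<dots> \<le> 1"
    proof (rule prod_le_1, intro conjI)
      fix p assume "p \<in> {p. prime p} \<inter> {..X}"
      then have p: "p \<ge> 2" using prime_ge_2_nat by auto
      \<comment> \<open>The power of p at the point with ordinate j t is r w^j: r is its modulus, w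
        the unimodular factor at ordinate t.\<close>
      define r where "r = real p powr (- \<sigma>)"
      define w where "w = (of_nat p powr (- \<i> * of_real t) :: complex)"
      have nw: "norm w = 1" using p by (simp add: w_def norm_of_nat_powr)
      have r1: "r < 1" using p \<sigma> powr_less_mono[of "- \<sigma>" 0 "real p"] by (simp add: r_def)
      have r_eq: "of_real r = (of_nat p powr (- of_real \<sigma>) :: complex)"
        by (simp add: r_def flip: powr_of_real)
      have e0: "of_nat p powr (- ?s 0) = (of_real r :: complex)"
        by (simp add: r_eq Complex_eq)
      have e1: "of_nat p powr (- ?s 1) = of_real r * w"
        by (simp add: r_eq w_def Complex_eq flip: powr_add)
      have e2: "of_nat p powr (- ?s 2) = of_real r * w\<^sup>2"
        by (simp add: r_eq w_def Complex_eq power2_eq_square algebra_simps flip: powr_add)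
      show "norm (1 - of_nat p powr (- ?s 0) :: complex) ^ 3
          * norm (1 - of_nat p powr (- ?s 1) :: complex) ^ 4 * norm (1 - of_nat p powr (- ?s 2) :: complex) \<le> 1"
        unfolding e0 e1 e2 using r1 nw by (intro three_four_one_local) (auto simp: r_def)
    qed auto
    finally show ?thesis .
  qed
  have zm: "?\<zeta> j * ?\<mu> j = 1" for j
    using zeta_series_times_moebius_series[of "?s j"] \<sigma> by (simp flip: norm_mult)
  have lim: "(\<lambda>X. ?E (?s j) X) \<longlonglongrightarrow> moebius_series (?s j)" for j
    using \<sigma> by (intro moebius_series_euler_product) simp
  have "?\<mu> 0 ^ 3 * ?\<mu> 1 ^ 4 * ?\<mu> 2 \<le> 1"
    by (rule tendsto_upperbound[OF tendsto_mult[OF tendsto_mult[OF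
          tendsto_power[OF tendsto_norm[OF lim]] tendsto_power[OF tendsto_norm[OF lim]]]
          tendsto_norm[OF lim]] always_eventually[OF allI[OF le]] sequentially_bot])
  then have "(?\<zeta> 0 ^ 3 * ?\<zeta> 1 ^ 4 * ?\<zeta> 2) * (?\<mu> 0 ^ 3 * ?\<mu> 1 ^ 4 * ?\<mu> 2)
      \<le> (?\<zeta> 0 ^ 3 * ?\<zeta> 1 ^ 4 * ?\<zeta> 2) * 1"
    by (intro mult_left_mono) auto
  also have "(?\<zeta> 0 ^ 3 * ?\<zeta> 1 ^ 4 * ?\<zeta> 2) * (?\<mu> 0 ^ 3 * ?\<mu> 1 ^ 4 * ?\<mu> 2)
      = (?\<zeta> 0 * ?\<mu> 0) ^ 3 * (?\<zeta> 1 * ?\<mu> 1) ^ 4 * (?\<zeta> 2 * ?\<mu> 2)"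
    by (simp add: power_mult_distrib mult_ac)
  also have "\<dots> = 1" unfolding zm by simp
  finally show ?thesis by (simp add: complex_of_real_def)
qed

section \<open>Continuation of z \<zeta>(1 + z) across the imaginary axis\<close>

text \<open>This is \<open>z \<zeta>(1 + z)\<close>, continued to \<open>Re z > -1\<close>: the \<open>n\<close>-th term is the first-order
  Taylor remainder of \<open>x \<mapsto> x powr (-z)\<close> between \<open>n\<close> and \<open>n + 1\<close>, and the remaining differences telescope.\<close>

definition zeta_term :: "nat \<Rightarrow> complex \<Rightarrow> complex" where
  "zeta_term n z = z * of_nat n powr (-1 - z) - of_nat n powr (-z) + of_nat (Suc n) powr (-z)"

definition shifted_zeta :: "complex \<Rightarrow> complex" where
  "shifted_zeta z = 1 + (\<Sum>n. zeta_term (Suc n) z)"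

text \<open>The Taylor remainder is controlled by the second derivative z (z + 1) x powr (-2 - z).
  The condition Re z \<ge> -2 makes its norm nonincreasing in x, so its largest value on the segment
  is at n.\<close>

lemma norm_zeta_term_le:
  assumes n: "n > 0" and z: "Re z \<ge> -2"
  shows "norm (zeta_term n z) \<le> norm z * norm (z + 1) * real n powr (-2 - Re z)"
proof -
  let ?S = "closed_segment (of_nat n) (of_nat (Suc n)) :: complex set"
  define f where "f i x = (if i = (0::nat) then x powr (-z) else if i = 1 then - z * x powr (-1 - z)
      else - z * ((-1 - z) * x powr (-2 - z)))" for i and x :: complex
  have S: "\<exists>u\<ge>real n. x = of_real u" if "x \<in> ?S" for x
  proof -
    have "x \<in> of_real ` closed_segment (real n) (real (Suc n))"
      using that unfolding closed_segment_of_real[symmetric] by simp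
    then show ?thesis by (auto simp: closed_segment_eq_real_ivl)
  qed
  have "norm (f 0 (of_nat (Suc n)) - (\<Sum>i\<le>1. f i (of_nat n) * (of_nat (Suc n) - of_nat n) ^ i / fact i))
      \<le> (norm z * norm (z + 1) * real n powr (-2 - Re z)) * norm (of_nat (Suc n) - of_nat n :: complex) ^ Suc 1 / fact 1"
  proof (rule complex_Taylor[where S = ?S])
    fix i x assume x: "x \<in> ?S" and i: "i \<le> (1::nat)"
    obtain u where u: "u \<ge> real n" "x = of_real u" using S[OF x] by blast
    have x0: "x \<notin> \<real>\<^sub>\<le>\<^sub>0" using u n by (auto simp: complex_nonpos_Reals_iff)
    have eqs: "- z - 1 = - 1 - z" "- 1 - z - 1 = - 2 - z" by simp_all
    have "f 0 = (\<lambda>x. x powr (-z))" "f 1 = (\<lambda>x. - z * x powr (-1 - z))"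
      by (auto simp: f_def fun_eq_iff)
    then have "(f 0 has_field_derivative f 1 x) (at x)" "(f 1 has_field_derivative f (Suc 1) x) (at x)"
      using has_field_derivative_powr[OF x0, of "- z"]
        DERIV_cmult[OF has_field_derivative_powr[OF x0, of "- 1 - z"], of "- z"]
      unfolding eqs by (simp_all add: f_def)
    moreover have "i = 0 \<or> i = 1" using i by auto
    ultimately show "(f i has_field_derivative f (Suc i) x) (at x within ?S)"
      by (auto intro: has_field_derivative_at_within)
  next
    fix x assume x: "x \<in> ?S"
    obtain u where u: "u \<ge> real n" "x = of_real u" using S[OF x] by blast
    have "norm (x powr (-2 - z)) = u powr (-2 - Re z)"
      using u n by (simp add: norm_powr_real_powr)
    also have "\<dots> \<le> real n powr (-2 - Re z)"
      using u n z by (intro powr_mono2') auto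
    finally have "norm z * norm (z + 1) * norm (x powr (-2 - z)) \<le> norm z * norm (z + 1) * real n powr (-2 - Re z)"
      by (intro mult_left_mono) auto
    moreover have "norm (-1 - z) = norm (z + 1)"
      by (metis minus_add_distrib add.commute norm_minus_cancel uminus_add_conv_diff diff_minus_eq_add add_uminus_conv_diff)
    ultimately show "norm (f (Suc 1) x) \<le> norm z * norm (z + 1) * real n powr (-2 - Re z)"
      by (simp add: f_def norm_mult)
  qed auto
  moreover have "f 0 (of_nat (Suc n)) - (\<Sum>i\<le>1. f i (of_nat n) * (of_nat (Suc n) - of_nat n) ^ i / fact i) = zeta_term n z"
    by (simp add: f_def zeta_term_def)
  ultimately show ?thesis by simp
qed

text \<open>For Re z > -1/2 the terms are locally uniformly O(n powr (-3/2)), so the Weierstrass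
  test applies. This half-plane leaves room to the left of the imaginary axis for the
  contour.\<close>

lemma holomorphic_shifted_zeta: "shifted_zeta holomorphic_on {z. Re z > -1/2}"
proof -
  have op: "open {z. Re z > -1/2}" by (rule open_halfspace_Re_gt)
  have "(\<lambda>z. \<Sum>n. zeta_term (Suc n) z) holomorphic_on {z. Re z > -1/2}"
  proof (rule holomorphic_uniform_sequence[OF op])
    fix k
    show "(\<lambda>z. \<Sum>n<k. zeta_term (Suc n) z) holomorphic_on {z. Re z > -1/2}"
      unfolding zeta_term_def by (intro holomorphic_intros)
  next
    fix x assume "x \<in> {z. Re z > -1/2}"
    then obtain d where d: "d > 0" "cball x d \<subseteq> {z. Re z > -1/2}"
      using op open_contains_cball by blast
    define K where "K = norm x + d"
    have "uniform_limit (cball x d) (\<lambda>k z. \<Sum>n<k. zeta_term (Suc n) z) (\<lambda>z. \<Sum>n. zeta_term (Suc n) z) sequentially"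
    proof (rule Weierstrass_m_test)
      fix n z assume z: "z \<in> cball x d"
      have nz: "norm z \<le> K"
        using z norm_triangle_ineq2[of z x] by (auto simp: K_def dist_norm norm_minus_commute)
      have nz1: "norm (z + 1) \<le> K + 1"
        using nz norm_triangle_ineq[of z 1] by simp
      have Rz: "Re z > -1/2" using z d by auto
      have "norm (zeta_term (Suc n) z) \<le> norm z * norm (z + 1) * real (Suc n) powr (-2 - Re z)"
        using Rz by (intro norm_zeta_term_le) auto
      also have "-2 - Re z \<le> -3/2" using Rz by (simp add: field_simps)
      then have "norm z * norm (z + 1) * real (Suc n) powr (-2 - Re z) \<le> K * (K + 1) * real (Suc n) powr (-3/2)"
        using nz nz1 d by (intro mult_mono powr_mono) (auto simp: K_def)
      finally show "norm (zeta_term (Suc n) z) \<le> K * (K + 1) * real (Suc n) powr (-3/2)" .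
    next
      have "summable (\<lambda>n. real n powr (-3/2))" by (simp add: summable_real_powr_iff)
      then show "summable (\<lambda>n. K * (K + 1) * real (Suc n) powr (-3/2))"
        by (intro summable_mult) (subst summable_Suc_iff)
    qed
    with d show "\<exists>d>0. cball x d \<subseteq> {z. Re z > -1/2} \<and>
        uniform_limit (cball x d) (\<lambda>k z. \<Sum>n<k. zeta_term (Suc n) z) (\<lambda>z. \<Sum>n. zeta_term (Suc n) z) sequentially"
      by blast
  qed
  then show ?thesis unfolding shifted_zeta_def[abs_def] by (intro holomorphic_intros)
qed

lemma shifted_zeta_0: "shifted_zeta 0 = 1"
  by (simp add: shifted_zeta_def zeta_term_def del: of_nat_Suc)

text \<open>For Re z > 0 the two pieces of \<open>zeta_term\<close> converge separately: one gives z
  \<zeta>(1 + z), the other telescopes to -1, which the leading 1 of \<open>shifted_zeta\<close>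
  cancels.\<close>

lemma shifted_zeta_eq:
  assumes z: "Re z > 0"
  shows "shifted_zeta z = z * zeta_series (1 + z)"
proof -
  have "(\<lambda>n. of_nat n powr (- (1 + z))) sums zeta_series (1 + z)"
    unfolding zeta_series_def using summable_norm_of_nat_powr[of "1 + z"] z
    by (intro summable_sums) (auto intro: summable_norm_cancel)
  then have "(\<lambda>n. of_nat (Suc n) powr (- (1 + z))) sums zeta_series (1 + z)"
    by (subst sums_Suc_iff) simp
  then have 1: "(\<lambda>n. z * of_nat (Suc n) powr (-1 - z)) sums (z * zeta_series (1 + z))"
    by (intro sums_mult) (simp add: algebra_simps del: of_nat_Suc)
  have "(\<lambda>n. of_nat (Suc n) powr (-z) :: complex) \<longlonglongrightarrow> 0"
  proof (rule tendsto_norm_zero_cancel)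
    have "(\<lambda>n. real n powr (- Re z)) \<longlonglongrightarrow> 0"
      using z by (intro tendsto_neg_powr filterlim_real_sequentially) auto
    then show "(\<lambda>n. norm (of_nat (Suc n) powr (-z) :: complex)) \<longlonglongrightarrow> 0"
      unfolding norm_of_nat_powr by (intro LIMSEQ_Suc) simp
  qed
  from telescope_sums[OF this]
  have 2: "(\<lambda>n. of_nat (Suc (Suc n)) powr (-z) - of_nat (Suc n) powr (-z) :: complex) sums (-1)"
    by simp
  have "(\<lambda>n. zeta_term (Suc n) z) sums (z * zeta_series (1 + z) + -1)"
    using sums_add[OF 1 2] by (simp add: zeta_term_def algebra_simps del: of_nat_Suc)
  then show ?thesis by (simp add: shifted_zeta_def sums_iff)
qed

lemma shifted_zeta_nonzero_of_Re_pos: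
  assumes "Re z > 0"
  shows "shifted_zeta z \<noteq> 0"
  using assms zeta_series_times_moebius_series[of "1 + z"] by (auto simp: shifted_zeta_eq)

lemma isCont_shifted_zeta: "Re z > -1/2 \<Longrightarrow> isCont shifted_zeta z"
  using holomorphic_shifted_zeta open_halfspace_Re_gt[of "-1/2"]
  by (metis (mono_tags) continuous_on_eq_continuous_at holomorphic_on_imp_continuous_on mem_Collect_eq)

text \<open>By the 3-4-1 inequality a zero at z = it, entering with exponent 4, would outweigh the
  pole of zeta at 1, entering with exponent 3, while the value at 2it stays bounded. The case t = 0
  is excluded by \<open>shifted_zeta_0\<close>.\<close>

lemma shifted_zeta_nonzero:
  assumes "Re z \<ge> 0"
  shows "shifted_zeta z \<noteq> 0"
proof
  assume zero: "shifted_zeta z = 0"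
  define t where "t = Im z"
  have Rz: "Re z = 0" using assms zero shifted_zeta_nonzero_of_Re_pos[of z] by force
  have z: "z = Complex 0 t" using Rz by (simp add: t_def complex_eq_iff)
  have t: "t \<noteq> 0"
  proof
    assume "t = 0"
    then show False using z zero shifted_zeta_0 by (simp flip: zero_complex.code)
  qed
  have "shifted_zeta field_differentiable (at z)"
    using holomorphic_shifted_zeta open_halfspace_Re_gt[of "-1/2"] Rz
    by (intro holomorphic_on_imp_differentiable_at) auto
  then obtain D where "DERIV shifted_zeta z :> D" by (auto simp: field_differentiable_def)
  then have D: "((\<lambda>h. shifted_zeta (z + h) / h) \<longlongrightarrow> D) (at 0)"
    using zero by (simp add: DERIV_def)
  have at0: "filterlim (of_real :: real \<Rightarrow> complex) (at 0) (at_right 0)"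
    unfolding filterlim_at
    by (auto intro!: tendsto_eq_intros simp: eventually_at_filter)
  have lim_real: "((\<lambda>x. of_real x :: complex) \<longlongrightarrow> 0) (at_right 0)"
    using at0 by (simp add: filterlim_at)
  let ?Z = "\<lambda>j x. shifted_zeta (of_real x + Complex 0 (j * t))"
  have limZ: "(?Z j \<longlongrightarrow> shifted_zeta (0 + Complex 0 (j * t))) (at_right 0)" for j
    by (rule isCont_tendsto_compose[OF isCont_shifted_zeta tendsto_add[OF lim_real tendsto_const]]) simp
  have lim1: "((\<lambda>x. ?Z 1 x / of_real x) \<longlongrightarrow> D) (at_right 0)"
    using filterlim_compose[OF D at0] by (simp add: z add.commute)
  \<comment> \<open>With |w_j| = |x + i j t| one has |\<open>?Z j x\<close>| = |w_j| times a zeta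
    value, and |w_0| = x. The powers of x in \<open>g\<close> cancel, so \<open>g\<close> is
    \<open>h\<close> times the 3-4-1 product and \<open>h x\<close> \<le> \<open>g x\<close>. But
    \<open>g\<close> tends to 0 because of the leading x, whereas the limit of \<open>h\<close> is
    positive.\<close>
  define g where "g x = x * (norm (?Z 0 x) ^ 3 * norm (?Z 1 x / of_real x) ^ 4 * norm (?Z 2 x))" for x :: real
  define h where "h x = norm (of_real x + Complex 0 (1 * t)) ^ 4 * norm (of_real x + Complex 0 (2 * t))" for x :: real
  have "(g \<longlongrightarrow> 0 * (norm (shifted_zeta (0 + Complex 0 (0 * t))) ^ 3 * norm D ^ 4 *
      norm (shifted_zeta (0 + Complex 0 (2 * t))))) (at_right 0)"
    unfolding g_def by (intro tendsto_intros limZ lim1)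
  then have g: "(g \<longlongrightarrow> 0) (at_right 0)" by simp
  have h: "(h \<longlongrightarrow> norm (0 + Complex 0 (1 * t)) ^ 4 * norm (0 + Complex 0 (2 * t))) (at_right 0)"
    unfolding h_def by (intro tendsto_intros lim_real)
  have "h x \<le> g x" if x: "x > 0" for x
  proof -
    let ?w = "\<lambda>j. of_real x + Complex 0 (j * t)"
    have eq: "norm (?Z j x) = norm (?w j) * norm (zeta_series (Complex (1 + x) (j * t)))" for j
    proof -
      have "?Z j x = ?w j * zeta_series (1 + ?w j)" using x by (intro shifted_zeta_eq) simp
      moreover have "1 + ?w j = Complex (1 + x) (j * t)" by (simp add: complex_eq_iff)
      ultimately show ?thesis by (simp add: norm_mult)
    qed
    have "1 \<le> norm (zeta_series (Complex (1 + x) (0 * t))) ^ 3 * norm (zeta_series (Complex (1 + x) (1 * t))) ^ 4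
        * norm (zeta_series (Complex (1 + x) (2 * t)))"
      using three_four_one[of "1 + x" t] x by (simp add: complex_of_real_def)
    then have "h x * 1 \<le> h x * \<dots>"
      by (intro mult_left_mono) (auto simp: h_def)
    also have "\<dots> = g x"
    proof -
      have "b ^ 4 * c * (u ^ 3 * v ^ 4 * w) = x * ((x * u) ^ 3 * (b * v / x) ^ 4 * (c * w))"
        for b c u v w :: real
        using x by (simp add: field_simps power4_eq_xxxx power3_eq_cube)
      moreover have w0: "norm (?w 0) = x" and nx: "norm (of_real x :: complex) = x"
        using x by (simp_all flip: zero_complex.code)
      ultimately show ?thesis unfolding g_def h_def norm_divide eq w0 nx by blast
    qed
    finally show ?thesis by simp
  qed
  then have "eventually (\<lambda>x. h x \<le> g x) (at_right 0)"
    by (auto simp: eventually_at_filter)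
  from tendsto_le[OF _ g h this] have "norm (Complex 0 t) ^ 4 * norm (Complex 0 (2 * t)) \<le> 0" by simp
  moreover have "norm (Complex 0 t) ^ 4 * norm (Complex 0 (2 * t)) > 0"
    using t by (auto simp: complex_eq_iff)
  ultimately show False by linarith
qed

section \<open>Newman's contour argument\<close>

text \<open>An entire function of z whose value at 0 is the partial sum of \<mu>(n)/n; Cauchy's
  formula at 0 is to recover that value.\<close>

definition moebius_partial :: "nat \<Rightarrow> complex \<Rightarrow> complex" where
  "moebius_partial N z = (\<Sum>n=1..N. of_real (moebius_mu n) * of_nat n powr (-1 - z))"

lemma powr_diff_mean_value:
  fixes a e :: real
  assumes "a > 0"
  obtains \<xi> where "a < \<xi>" "\<xi> < a + 1" "(a + 1) powr e - a powr e = e * \<xi> powr (e - 1)"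
proof -
  have "\<exists>\<xi>. a < \<xi> \<and> \<xi> < a + 1 \<and> (a + 1) powr e - a powr e = (a + 1 - a) * (e * \<xi> powr (e - 1))"
    using assms by (intro MVT2) (auto intro!: derivative_eq_intros)
  then show ?thesis using that by auto
qed

text \<open>By the mean value theorem each term is at most a difference of consecutive values of n
  powr (-x) / x, and these telescope. The factor 1 / Re z will be cancelled by the kernel on the
  arc.\<close>

lemma norm_moebius_partial_tail_le:
  assumes N: "N \<ge> 1" and z: "Re z > 0"
  shows "norm (moebius_series (1 + z) - moebius_partial N z) \<le> real N powr (- Re z) / Re z"
proof -
  define x where "x = Re z"
  have x: "x > 0" using z by (simp add: x_def)
  let ?a = "\<lambda>n. of_real (moebius_mu n) * of_nat n powr (- (1 + z)) :: complex"
  have summ: "summable (\<lambda>n. norm (?a n))" using z by (intro summable_moebius_series) simp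
  have "?a sums moebius_series (1 + z)"
    unfolding moebius_series_def by (rule summable_sums[OF summable_norm_cancel[OF summ]])
  then have "(\<lambda>k. ?a (k + Suc N)) sums (moebius_series (1 + z) - (\<Sum>n<Suc N. ?a n))"
    by (rule sums_split_initial_segment)
  moreover have "(\<Sum>n<Suc N. ?a n) = moebius_partial N z"
    unfolding moebius_partial_def
    by (intro sum.mono_neutral_cong_right) (auto simp: moebius_mu_def algebra_simps)
  ultimately have tail: "(\<lambda>k. ?a (k + Suc N)) sums (moebius_series (1 + z) - moebius_partial N z)"
    by simp
  let ?f = "\<lambda>k. real (k + N) powr (- x)"
  have "?f \<longlonglongrightarrow> 0"
    using x by (intro tendsto_neg_powr filterlim_compose[OF filterlim_real_sequentially]
        filterlim_add_const_nat_at_top) auto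
  from sums_divide[OF telescope_sums'[OF this], of x]
  have tele: "(\<lambda>k. (?f k - ?f (Suc k)) / x) sums (real N powr (- x) / x)" by simp
  have le: "norm (?a (k + Suc N)) \<le> (?f k - ?f (Suc k)) / x" for k
  proof -
    obtain \<xi> where \<xi>: "real (k + N) < \<xi>" "\<xi> < real (k + N) + 1"
      "(real (k + N) + 1) powr (- x) - real (k + N) powr (- x) = - x * \<xi> powr (- x - 1)"
      using powr_diff_mean_value[of "real (k + N)" "- x"] N by auto
    have re: "Re (- (1 + z)) = - x - 1" by (simp add: x_def)
    have "norm (?a (k + Suc N)) \<le> real (k + Suc N) powr (- x - 1)"
      unfolding norm_mult norm_of_nat_powr re norm_of_real using abs_moebius_mu_le[of "k + Suc N"]
      by (intro mult_left_le_one_le) auto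
    also have "\<dots> \<le> \<xi> powr (- x - 1)"
      using \<xi>(1,2) N x by (intro powr_mono2') auto
    also have "\<dots> = (?f k - ?f (Suc k)) / x"
      using \<xi>(3) x by (simp add: field_simps)
    finally show ?thesis .
  qed
  have summ_tail: "summable (\<lambda>k. norm (?a (k + Suc N)))"
    using summ by (subst summable_iff_shift)
  have "norm (moebius_series (1 + z) - moebius_partial N z) = norm (\<Sum>k. ?a (k + Suc N))"
    using tail by (simp add: sums_iff)
  also have "\<dots> \<le> (\<Sum>k. norm (?a (k + Suc N)))"
    by (rule summable_norm[OF summ_tail])
  also have "\<dots> \<le> (\<Sum>k. (?f k - ?f (Suc k)) / x)"
    by (intro suminf_le le summ_tail sums_summable[OF tele])
  also have "\<dots> = real N powr (- x) / x" using tele by (simp add: sums_iff)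
  finally show ?thesis by (simp add: x_def)
qed

text \<open>Comparison with the integral of u powr (x - 1), whose monotonicity changes at x = 1. In
  the increasing case each term is compared with the interval to its right, so the last term stays
  over and appears separately in the bound.\<close>

lemma sum_powr_le:
  fixes x :: real
  assumes x: "x > 0" and N: "N \<ge> 1"
  shows "(\<Sum>n=1..N. real n powr (x - 1)) \<le> real N powr x / x + real N powr (x - 1)"
proof (cases "x \<le> 1")
  case True
  have "(\<Sum>n=1..N. real n powr (x - 1)) \<le> real N powr x / x"
    using N
  proof (induction N rule: nat_induct_at_least)
    case base
    then show ?case using x True by simp
  next
    case (Suc n)
    obtain \<xi> where \<xi>: "real n < \<xi>" "\<xi> < real n + 1"
      "(real n + 1) powr x - real n powr x = x * \<xi> powr (x - 1)"
      using powr_diff_mean_value[of "real n" x] Suc.hyps by auto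
    have "real (Suc n) powr (x - 1) \<le> \<xi> powr (x - 1)"
      using \<xi> True Suc.hyps by (intro powr_mono2') auto
    also have "\<dots> = real (Suc n) powr x / x - real n powr x / x"
      using \<xi>(3) x by (simp add: field_simps)
    finally show ?case using Suc by simp
  qed
  then show ?thesis by (simp add: add_increasing2)
next
  case False
  show ?thesis
    using N
  proof (induction N rule: nat_induct_at_least)
    case base
    then show ?case using x by simp
  next
    case (Suc n)
    obtain \<xi> where \<xi>: "real n < \<xi>" "\<xi> < real n + 1"
      "(real n + 1) powr x - real n powr x = x * \<xi> powr (x - 1)"
      using powr_diff_mean_value[of "real n" x] Suc.hyps by auto
    have "real n powr (x - 1) \<le> \<xi> powr (x - 1)"
      using \<xi> False by (intro powr_mono2) auto
    also have "\<dots> = real (Suc n) powr x / x - real n powr x / x"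
      using \<xi>(3) x by (simp add: field_simps)
    finally show ?case using Suc by simp
  qed
qed

lemma norm_moebius_partial_le:
  assumes N: "N \<ge> 1" and z: "Re z < 0"
  shows "norm (moebius_partial N z) \<le> real N powr (- Re z) / (- Re z) + real N powr (- Re z - 1)"
proof -
  have "norm (moebius_partial N z) \<le> (\<Sum>n=1..N. real n powr (- Re z - 1))"
    unfolding moebius_partial_def
  proof (rule sum_norm_le)
    fix n
    have "norm (of_real (moebius_mu n) * of_nat n powr (-1 - z) :: complex) = \<bar>moebius_mu n\<bar> * real n powr (- Re z - 1)"
    proof -
      have "Re (-1 - z) = - Re z - 1" by simp
      then show ?thesis by (simp only: norm_mult norm_of_nat_powr norm_of_real)
    qed
    also have "\<dots> \<le> real n powr (- Re z - 1)"
      using abs_moebius_mu_le[of n] by (intro mult_left_le_one_le) auto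
    finally show "norm (of_real (moebius_mu n) * of_nat n powr (-1 - z) :: complex) \<le> real n powr (- Re z - 1)" .
  qed
  also have "\<dots> \<le> real N powr (- Re z) / (- Re z) + real N powr (- Re z - 1)"
    using assms by (intro sum_powr_le) auto
  finally show ?thesis .
qed

text \<open>On the circle 1/z + z/R^2 is the real number 2 Re z / R^2. It vanishes where the circle
  meets the imaginary axis and so absorbs the factor 1 / |Re z| in the bounds for the tail and for
  the partial sum.\<close>

lemma norm_newman_kernel:
  assumes "norm z = R" "R > 0"
  shows "norm ((1 + z\<^sup>2 / of_real (R\<^sup>2)) / z) = 2 * \<bar>Re z\<bar> / R\<^sup>2"
proof -
  have z0: "z \<noteq> 0" using assms by auto
  have "z * cnj z = of_real (R\<^sup>2)" by (metis assms(1) complex_norm_square)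
  then have "1 + z\<^sup>2 / of_real (R\<^sup>2) = z * (cnj z + z) / of_real (R\<^sup>2)"
    using assms by (simp add: field_simps power2_eq_square)
  then have "(1 + z\<^sup>2 / of_real (R\<^sup>2)) / z = of_real (2 * Re z / R\<^sup>2)"
    using z0 by (simp add: complex_add_cnj add.commute)
  then show ?thesis by (simp only: norm_of_real) (simp add: abs_mult)
qed

section \<open>The semicircles and the contour estimate\<close>

lemma in_right_semicircle:
  assumes "z \<in> path_image (part_circlepath 0 R (- (pi / 2)) (pi / 2))" "R > 0"
  shows "norm z = R" "Re z \<ge> 0"
proof -
  obtain t where t: "- (pi / 2) \<le> t" "t \<le> pi / 2" "z = of_real R * exp (\<i> * of_real t)"
    using assms by (auto simp: path_image_part_circlepath)
  then show "norm z = R" using assms by (simp add: norm_mult)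
  have "Re z = R * cos t" by (simp add: t flip: cis_conv_exp)
  then show "Re z \<ge> 0" using t assms by (simp add: cos_ge_zero)
qed

lemma in_left_semicircle:
  assumes "z \<in> path_image (part_circlepath 0 R (pi / 2) (3 * pi / 2))" "R > 0"
  shows "norm z = R" "Re z \<le> 0"
proof -
  obtain t where t: "pi / 2 \<le> t" "t \<le> 3 * pi / 2" "z = of_real R * exp (\<i> * of_real t)"
    using assms by (auto simp: path_image_part_circlepath)
  then show "norm z = R" using assms by (simp add: norm_mult)
  have "Re z = - (R * cos (t - pi))" by (simp add: t cos_diff flip: cis_conv_exp)
  moreover have "R * cos (t - pi) \<ge> 0"
    using t assms(2) by (intro mult_nonneg_nonneg cos_ge_zero) auto
  ultimately show "Re z \<le> 0" by linarith
qed

text \<open>Cauchy's formula is applied to the whole circle, parametrized from -\<pi>/2 to 3\<pi>/2,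
  and the integral over the parameter is then split at \<pi>/2.\<close>

lemma cauchy_formula_two_semicircles:
  assumes f: "f holomorphic_on UNIV" and R: "R > 0"
  shows "contour_integral (part_circlepath 0 R (- (pi / 2)) (pi / 2)) (\<lambda>z. f z / z) +
    contour_integral (part_circlepath 0 R (pi / 2) (3 * pi / 2)) (\<lambda>z. f z / z) = 2 * pi * \<i> * f 0"
proof -
  let ?C = "part_circlepath 0 R (- (pi / 2)) (3 * pi / 2)"
  have im: "path_image (part_circlepath 0 R a b) \<subseteq> UNIV - {0}" for a b
    using path_image_part_circlepath_subset'[of R 0 a b] R by auto
  have "cos (3 * pi / 2) = 0" "sin (3 * pi / 2) = -1"
    using cos_3over2_pi sin_3over2_pi by simp_all
  then have ends: "pathfinish ?C = pathstart ?C"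
    by (simp only: pathstart_part_circlepath pathfinish_part_circlepath cis_conv_exp[symmetric])
      (simp add: complex_eq_iff)
  \<comment> \<open>The winding number is read off the parametrization: the integrand becomes the
    constant \<i> on an interval of length 2\<pi>.\<close>
  have "winding_number ?C 0 = 1 / (2 * pi * \<i>) * contour_integral ?C (\<lambda>w. 1 / (w - 0))"
    using im by (intro winding_number_valid_path) auto
  also have "contour_integral ?C (\<lambda>w. 1 / (w - 0)) = integral {- (pi / 2)..3 * pi / 2} (\<lambda>t. \<i>)"
    using R pi_gt_zero by (subst contour_integral_part_circlepath_eq) (auto intro!: integral_cong)
  also have "\<dots> = 2 * pi * \<i>"
    using pi_gt_zero by (simp add: scaleR_conv_of_real)
  finally have wn: "winding_number ?C 0 = 1" by simp
  have "((\<lambda>w. f w / (w - 0)) has_contour_integral (2 * pi * \<i> * winding_number ?C 0 * f 0)) ?C"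
    using f im ends by (intro Cauchy_integral_formula_convex_simple[where S = UNIV]) auto
  then have C: "((\<lambda>z. f z / z) has_contour_integral (2 * pi * \<i> * f 0)) ?C" by (simp add: wn)
  let ?g = "\<lambda>t. f (0 + of_real R * cis t) / (0 + of_real R * cis t) * of_real R * \<i> * cis t"
  have int: "(\<lambda>z. f z / z) contour_integrable_on part_circlepath 0 R a b" for a b
    using im[of a b] f by (intro contour_integrable_continuous_part_circlepath continuous_intros)
      (auto intro: continuous_on_subset holomorphic_on_imp_continuous_on)
  have "(?g has_integral contour_integral (part_circlepath 0 R (- (pi / 2)) (pi / 2)) (\<lambda>z. f z / z)) {- (pi / 2)..pi / 2}"
    using has_contour_integral_integral[OF int[of "- (pi / 2)" "pi / 2"]] pi_gt_zero
    by (subst (asm) has_contour_integral_part_circlepath_iff) auto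
  moreover have "(?g has_integral contour_integral (part_circlepath 0 R (pi / 2) (3 * pi / 2)) (\<lambda>z. f z / z)) {pi / 2..3 * pi / 2}"
    using has_contour_integral_integral[OF int[of "pi / 2" "3 * pi / 2"]] pi_gt_zero
    by (subst (asm) has_contour_integral_part_circlepath_iff) auto
  ultimately have "(?g has_integral (contour_integral (part_circlepath 0 R (- (pi / 2)) (pi / 2)) (\<lambda>z. f z / z) +
      contour_integral (part_circlepath 0 R (pi / 2) (3 * pi / 2)) (\<lambda>z. f z / z))) {- (pi / 2)..3 * pi / 2}"
    using pi_gt_zero by (intro has_integral_combine[of _ "pi / 2"]) auto
  moreover have "(?g has_integral (2 * pi * \<i> * f 0)) {- (pi / 2)..3 * pi / 2}"
    using C pi_gt_zero by (subst (asm) has_contour_integral_part_circlepath_iff) auto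
  ultimately show ?thesis by (rule has_integral_unique)
qed

text \<open>The right arc contributes 2\<pi>/R, the left arc 2\<pi>/R + 2\<pi>/N, the two horizontal
  sides M \<eta> each, and the vertical side of length 2R the term with N powr (-\<eta>).\<close>

lemma newman_contour_bound:
  fixes R \<eta> M :: real
  assumes R: "R > 0" and \<eta>: "0 < \<eta>" "\<eta> < 1/2" and N: "N \<ge> 1"
    and nz: "\<And>z. - \<eta> \<le> Re z \<Longrightarrow> \<bar>Im z\<bar> \<le> R \<Longrightarrow> shifted_zeta z \<noteq> 0"
    and M: "\<And>z. - \<eta> \<le> Re z \<Longrightarrow> Re z \<le> 0 \<Longrightarrow> \<bar>Im z\<bar> \<le> R \<Longrightarrow>
      norm ((1 + z\<^sup>2 / of_real (R\<^sup>2)) / shifted_zeta z) \<le> M"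
  shows "2 * pi * norm (moebius_partial N 0) \<le>
    4 * pi / R + 2 * pi / real N + 2 * M * \<eta> + 2 * R * M * real N powr (- \<eta>)"
proof -
  let ?A = "part_circlepath 0 R (- (pi / 2)) (pi / 2)" and ?A' = "part_circlepath 0 R (pi / 2) (3 * pi / 2)"
  define k where "k z = 1 + z\<^sup>2 / of_real (R\<^sup>2)" for z :: complex
  \<comment> \<open>\<open>Q\<close> is regular at 0 because \<open>shifted_zeta\<close> is 1 there,
    so its integral over the closed contour is 0. For Re z > 0 it equals
    \<open>moebius_series (1 + z)\<close> times N^z k(z)/z, so \<open>Q z - f z / z\<close> contains
    only the tail of the Moebius series.\<close>
  define Q where "Q z = of_nat N powr z * (k z / shifted_zeta z)" for z :: complex
  define f where "f z = moebius_partial N z * of_nat N powr z * k z" for z :: complex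
  let ?D = "{z. - \<eta> \<le> Re z \<and> \<bar>Im z\<bar> \<le> R}"
  have N0: "(of_nat N :: complex) \<noteq> 0" using N by simp
  have holQ: "Q holomorphic_on ?D"
  proof -
    have "shifted_zeta holomorphic_on ?D"
      by (rule holomorphic_on_subset[OF holomorphic_shifted_zeta]) (use \<eta> in auto)
    then show ?thesis unfolding Q_def k_def using nz R
      by (intro holomorphic_intros) auto
  qed
  have holf: "f holomorphic_on UNIV"
    unfolding f_def k_def moebius_partial_def using R by (intro holomorphic_intros) auto
  have "convex ({z. Re z \<ge> - \<eta>} \<inter> ({z. Im z \<le> R} \<inter> {z. Im z \<ge> - R}))"
    by (intro convex_Int convex_halfspace_Re_ge convex_halfspace_Im_le convex_halfspace_Im_ge)
  moreover have "{z. Re z \<ge> - \<eta>} \<inter> ({z. Im z \<le> R} \<inter> {z. Im z \<ge> - R}) = ?D" by auto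
  ultimately have convD: "convex ?D" by simp
  define a b c d where "a = Complex 0 R" "b = Complex (- \<eta>) R" "c = Complex (- \<eta>) (- R)" "d = Complex 0 (- R)"
  note abcd = this
  have startA: "pathstart ?A = d" and finA: "pathfinish ?A = a"
    by (simp_all add: abcd complex_eq_iff exp_eq_polar Re_exp Im_exp)
  have mem: "a \<in> ?D" "b \<in> ?D" "c \<in> ?D" "d \<in> ?D" using R \<eta> by (auto simp: abcd)
  have seg: "closed_segment u v \<subseteq> ?D" if "u \<in> ?D" "v \<in> ?D" for u v
    using closed_segment_subset[OF that convD] .
  have imA: "path_image ?A \<subseteq> ?D"
    using in_right_semicircle[OF _ R] \<eta> abs_Im_le_cmod by fastforce
  let ?g = "?A +++ (linepath a b +++ (linepath b c +++ linepath c d))"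
  have closed: "(Q has_contour_integral 0) ?g"
    using holQ convD imA seg mem startA finA
    by (intro Cauchy_theorem_convex_simple[of Q ?D]) (auto intro!: valid_path_join simp: path_image_join)
  have contQ: "continuous_on ?D Q" using holQ by (rule holomorphic_on_imp_continuous_on)
  have intA: "Q contour_integrable_on ?A"
    using contQ imA by (intro contour_integrable_continuous_part_circlepath) (rule continuous_on_subset)
  have int_seg: "Q contour_integrable_on linepath u v" if "u \<in> ?D" "v \<in> ?D" for u v
    using contQ seg[OF that] by (intro contour_integrable_continuous_linepath) (rule continuous_on_subset)
  let ?I = "\<lambda>u v. contour_integral (linepath u v) Q"
  have zero: "contour_integral ?A Q + (?I a b + (?I b c + ?I c d)) = 0"
  proof -
    have "(Q has_contour_integral (contour_integral ?A Q + (?I a b + (?I b c + ?I c d)))) ?g"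
      using startA finA mem
      by (intro has_contour_integral_join has_contour_integral_integral intA int_seg valid_path_join) auto
    from has_contour_integral_unique[OF this closed] show ?thesis .
  qed
  have powr_le: "norm (of_nat N powr z :: complex) = real N powr Re z" for z
    by (rule norm_of_nat_powr)
  have "norm ((1 + 0\<^sup>2 / of_real (R\<^sup>2)) / shifted_zeta 0) \<le> M" using R \<eta> by (intro M) auto
  then have M0: "M \<ge> 0" by (rule order_trans[OF norm_ge_zero])
  have Q_le: "norm (Q z) \<le> M" if "- \<eta> \<le> Re z" "Re z \<le> 0" "\<bar>Im z\<bar> \<le> R" for z
  proof -
    have "real N powr Re z \<le> real N powr 0" using N that by (intro powr_mono) auto
    then have "norm (of_nat N powr z :: complex) \<le> 1" using N by (simp add: powr_le)
    then have "norm (Q z) \<le> 1 * M"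
      unfolding Q_def norm_mult k_def using M[OF that] by (intro mult_mono) auto
    then show ?thesis by simp
  qed
  have seg_le: "closed_segment u v \<subseteq> {z. - \<eta> \<le> Re z \<and> \<bar>Im z\<bar> \<le> R \<and> Re z \<le> s}"
    if "u \<in> ?D" "v \<in> ?D" "Re u \<le> s" "Re v \<le> s" for u v s
  proof -
    have "closed_segment u v \<subseteq> {z. Re z \<le> s}"
      using that by (intro closed_segment_subset convex_halfspace_Re_le) auto
    then show ?thesis using seg[OF that(1,2)] by auto
  qed
  have ab: "norm (?I a b) \<le> M * \<eta>"
  proof -
    have "norm (?I a b) \<le> M * norm (b - a)"
      using seg_le[OF mem(1,2), of 0] \<eta>
      by (intro contour_integral_bound_linepath int_seg mem M0 Q_le) (auto simp: abcd)
    also have "b - a = of_real (- \<eta>)" by (simp add: abcd complex_eq_iff)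
    finally show ?thesis using \<eta> by simp
  qed
  have cd: "norm (?I c d) \<le> M * \<eta>"
  proof -
    have "norm (?I c d) \<le> M * norm (d - c)"
      using seg_le[OF mem(3,4), of 0] \<eta>
      by (intro contour_integral_bound_linepath int_seg mem M0 Q_le) (auto simp: abcd)
    also have "d - c = of_real \<eta>" by (simp add: abcd complex_eq_iff)
    finally show ?thesis using \<eta> by simp
  qed
  have bc: "norm (?I b c) \<le> 2 * R * M * real N powr (- \<eta>)"
  proof -
    have "norm (?I b c) \<le> (real N powr (- \<eta>) * M) * norm (c - b)"
    proof (rule contour_integral_bound_linepath[OF int_seg[OF mem(2,3)]])
      fix z assume "z \<in> closed_segment b c"
      then have z: "- \<eta> \<le> Re z" "\<bar>Im z\<bar> \<le> R" "Re z \<le> - \<eta>"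
        using seg_le[OF mem(2,3), of "- \<eta>"] by (auto simp: abcd)
      then have "Re z = - \<eta>" by linarith
      then show "norm (Q z) \<le> real N powr (- \<eta>) * M"
        unfolding Q_def norm_mult k_def powr_le using M[of z] z \<eta> by (intro mult_mono) auto
    qed (use M0 in auto)
    also have "c - b = - (of_real (2 * R) * \<i>)" by (simp add: abcd complex_eq_iff)
    also have "norm \<dots> = 2 * R" using R by (simp only: norm_minus_cancel norm_mult norm_of_real) simp
    finally show ?thesis by (simp add: mult_ac)
  qed
  have intf: "(\<lambda>z. f z / z) contour_integrable_on part_circlepath 0 R u v" for u v
  proof (rule contour_integrable_continuous_part_circlepath)
    have "path_image (part_circlepath 0 R u v) \<subseteq> UNIV - {0}"
      using path_image_part_circlepath_subset'[of R 0 u v] R by auto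
    then show "continuous_on (path_image (part_circlepath 0 R u v)) (\<lambda>z. f z / z)"
      using holf by (intro continuous_intros) (auto intro: continuous_on_subset holomorphic_on_imp_continuous_on)
  qed
  have A: "norm (contour_integral ?A Q - contour_integral ?A (\<lambda>z. f z / z)) \<le> 2 * pi / R"
  proof -
    have "norm (contour_integral ?A (\<lambda>z. Q z - f z / z)) \<le> 2 / R\<^sup>2 * R * (pi / 2 - - (pi / 2))"
    \<comment> \<open>The endpoints are excepted because the tail bound requires Re z > 0. Elsewhere
      on the arc N powr (- Re z) / Re z meets N powr (Re z) and the kernel, and everything except
      2/R^2 cancels.\<close>
    proof (rule contour_integral_bound_part_circlepath_strong[where k = "{a, d}"])
      fix z assume z: "z \<in> path_image ?A - {a, d}"
      then have nzR: "norm z = R" "Re z \<ge> 0" using in_right_semicircle[OF _ R] by auto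
      have "Re z \<noteq> 0"
      proof
        assume "Re z = 0"
        then have "\<bar>Im z\<bar> = R" using nzR(1) by (simp add: cmod_eq_Im)
        then show False using z \<open>Re z = 0\<close> R by (auto simp: abcd complex_eq_iff abs_if split: if_splits)
      qed
      with nzR have x: "Re z > 0" by simp
      have z0: "z \<noteq> 0" using x by auto
      have "1 / shifted_zeta z = moebius_series (1 + z) / z"
        using zeta_series_times_moebius_series[of "1 + z"] x z0 shifted_zeta_nonzero[of z]
        by (simp add: shifted_zeta_eq field_simps)
      then have "Q z - f z / z = (moebius_series (1 + z) - moebius_partial N z) * of_nat N powr z * (k z / z)"
        unfolding Q_def f_def by (simp add: divide_inverse algebra_simps)
      then have "norm (Q z - f z / z) = norm (moebius_series (1 + z) - moebius_partial N z) * real N powr Re z * norm (k z / z)"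
        by (simp only: norm_mult powr_le)
      also have "norm (k z / z) = 2 * Re z / R\<^sup>2"
        unfolding k_def norm_newman_kernel[OF nzR(1) R] using x by simp
      also have "norm (moebius_series (1 + z) - moebius_partial N z) * real N powr Re z * (2 * Re z / R\<^sup>2)
          \<le> (real N powr (- Re z) / Re z) * real N powr Re z * (2 * Re z / R\<^sup>2)"
        using norm_moebius_partial_tail_le[OF N x] x by (intro mult_right_mono) auto
      also have "\<dots> = (real N powr (- Re z) * real N powr Re z) * (2 / R\<^sup>2)"
        using x by simp
      also have "real N powr (- Re z) * real N powr Re z = 1"
        using N by (simp flip: powr_add)
      finally show "norm (Q z - f z / z) \<le> 2 / R\<^sup>2" by simp
    qed (use R intA intf in \<open>auto intro!: contour_integrable_diff\<close>)
    also have "2 / R\<^sup>2 * R * (pi / 2 - - (pi / 2)) = 2 * pi / R"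
      using R by (simp add: power2_eq_square)
    finally show ?thesis using contour_integral_diff[OF intA intf] by simp
  qed
  have A': "norm (contour_integral ?A' (\<lambda>z. f z / z)) \<le> 2 * pi / R + 2 * pi / real N"
  proof -
    have "norm (contour_integral ?A' (\<lambda>z. f z / z)) \<le> (2 / R\<^sup>2 + 2 / (R * real N)) * R * (3 * pi / 2 - pi / 2)"
    proof (rule contour_integral_bound_part_circlepath_strong[where k = "{a, d}"])
      fix z assume z: "z \<in> path_image ?A' - {a, d}"
      then have nzR: "norm z = R" "Re z \<le> 0" using in_left_semicircle[OF _ R] by auto
      have "Re z \<noteq> 0"
      proof
        assume "Re z = 0"
        then have "\<bar>Im z\<bar> = R" using nzR(1) by (simp add: cmod_eq_Im)
        then show False using z \<open>Re z = 0\<close> R by (auto simp: abcd complex_eq_iff abs_if split: if_splits)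
      qed
      with nzR have x: "Re z < 0" by simp
      define x where "x = - Re z"
      have x0: "x > 0" "Re z = - x" using x by (auto simp: x_def)
      have xR: "x \<le> R" using nzR(1) abs_Re_le_cmod[of z] by (simp add: x_def)
      have "norm (f z / z) = norm (moebius_partial N z) * real N powr (- x) * norm (k z / z)"
        unfolding f_def times_divide_eq_right[symmetric] by (simp only: norm_mult powr_le x0)
      also have "norm (k z / z) = 2 * x / R\<^sup>2"
        unfolding k_def norm_newman_kernel[OF nzR(1) R] using x0 by simp
      also have "norm (moebius_partial N z) * real N powr (- x) * (2 * x / R\<^sup>2)
          \<le> (real N powr x / x + real N powr (x - 1)) * real N powr (- x) * (2 * x / R\<^sup>2)"
        using norm_moebius_partial_le[OF N x] x0 by (intro mult_right_mono) auto
      also have "\<dots> = (real N powr x * real N powr (- x) / x + real N powr (x - 1) * real N powr (- x)) * (2 * x / R\<^sup>2)"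
        by (simp add: ring_distribs)
      also have "real N powr x * real N powr (- x) = 1" using N by (simp flip: powr_add)
      also have "real N powr (x - 1) * real N powr (- x) = 1 / real N"
        using N powr_add[of "real N" "x - 1" "- x"] by (simp add: powr_minus_divide)
      also have "(1 / x + 1 / real N) * (2 * x / R\<^sup>2) = 2 / R\<^sup>2 + x * (2 / (R\<^sup>2 * real N))"
        using x0(1) N R by (simp add: field_simps)
      also have "\<dots> \<le> 2 / R\<^sup>2 + R * (2 / (R\<^sup>2 * real N))"
        using xR N R by (intro add_left_mono mult_right_mono) auto
      also have "\<dots> = 2 / R\<^sup>2 + 2 / (R * real N)"
        using R by (simp add: power2_eq_square)
      finally show "norm (f z / z) \<le> 2 / R\<^sup>2 + 2 / (R * real N)" .
    qed (use R N intf in auto)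
    also have "\<dots> = 2 * pi / R + 2 * pi / real N"
      using R N by (simp add: add_divide_distrib distrib_right power2_eq_square)
    finally show ?thesis .
  qed
  have f0: "f 0 = moebius_partial N 0" using N0 by (simp add: f_def k_def)
  \<comment> \<open>Cauchy's formula for \<open>f\<close> uses both arcs. On the right arc the
    integral of f z / z is that of \<open>Q\<close> minus their difference, and by
    \<open>zero\<close> the integral of \<open>Q\<close> there is minus the integrals over the three
    segments.\<close>
  have "2 * pi * \<i> * moebius_partial N 0 =
      contour_integral ?A' (\<lambda>z. f z / z) - (contour_integral ?A Q - contour_integral ?A (\<lambda>z. f z / z))
      - (?I a b + (?I b c + ?I c d))"
    using cauchy_formula_two_semicircles[OF holf R] zero unfolding f0 by (simp add: algebra_simps add_eq_0_iff)
  then have "norm (2 * pi * \<i> * moebius_partial N 0) \<le> norm (contour_integral ?A' (\<lambda>z. f z / z))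
      + norm (contour_integral ?A Q - contour_integral ?A (\<lambda>z. f z / z))
      + (norm (?I a b) + (norm (?I b c) + norm (?I c d)))"
    by (auto intro!: order_trans[OF norm_triangle_ineq4] order_trans[OF norm_triangle_ineq] add_mono)
  moreover have "norm (2 * pi * \<i> * moebius_partial N 0) = 2 * pi * norm (moebius_partial N 0)"
    by (simp add: norm_mult)
  ultimately show ?thesis using A A' ab bc cd by linarith
qed

text \<open>The segment from -iR to iR is compact and lies in the open set where
  \<open>shifted_zeta\<close> is nonzero, so a neighbourhood of it does too. The bound
  \<open>M\<close> exists by compactness of the rectangle to its left.\<close>

lemma shifted_zeta_nonzero_box:
  assumes R: "R > 0"
  obtains \<delta> M where "0 < \<delta>" "\<delta> < 1/2" "M > 0"
    "\<And>z. - \<delta> \<le> Re z \<Longrightarrow> \<bar>Im z\<bar> \<le> R \<Longrightarrow> shifted_zeta z \<noteq> 0"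
    "\<And>z. - \<delta> \<le> Re z \<Longrightarrow> Re z \<le> 0 \<Longrightarrow> \<bar>Im z\<bar> \<le> R \<Longrightarrow>
      norm ((1 + z\<^sup>2 / of_real (R\<^sup>2)) / shifted_zeta z) \<le> M"
proof -
  let ?H = "{z. Re z > -1/2}"
  have opH: "open ?H" by (rule open_halfspace_Re_gt)
  have cont: "continuous_on ?H shifted_zeta"
    using holomorphic_shifted_zeta by (rule holomorphic_on_imp_continuous_on)
  let ?U = "?H \<inter> shifted_zeta -` (- {0})"
  have opU: "open ?U" using cont opH by (intro continuous_open_preimage) auto
  let ?K = "cbox (Complex 0 (- R)) (Complex 0 R)"
  have "?K \<subseteq> ?U" using shifted_zeta_nonzero by (auto simp: in_cbox_complex_iff)
  then obtain \<epsilon> where \<epsilon>: "\<epsilon> > 0" "(\<Union>x\<in>?K. cball x \<epsilon>) \<subseteq> ?U"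
    using compact_subset_open_imp_cball_epsilon_subset[OF compact_cbox opU] by metis
  define \<delta> where "\<delta> = min \<epsilon> (1/4)"
  have \<delta>: "0 < \<delta>" "\<delta> < 1/2" "\<delta> \<le> \<epsilon>" using \<epsilon> by (auto simp: \<delta>_def)
  have nz: "shifted_zeta z \<noteq> 0" if z: "- \<delta> \<le> Re z" "\<bar>Im z\<bar> \<le> R" for z
  proof (cases "Re z \<ge> 0")
    case False
    have "z - Complex 0 (Im z) = of_real (Re z)" by (simp add: complex_eq_iff)
    then have "dist (Complex 0 (Im z)) z = \<bar>Re z\<bar>" by (simp add: dist_norm norm_minus_commute)
    then have "z \<in> cball (Complex 0 (Im z)) \<epsilon>" using z \<delta> False by simp
    moreover have "Complex 0 (Im z) \<in> ?K" using z by (auto simp: in_cbox_complex_iff)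
    ultimately show ?thesis using \<epsilon>(2) by blast
  qed (rule shifted_zeta_nonzero)
  let ?B = "cbox (Complex (- \<delta>) (- R)) (Complex 0 R)"
  have B: "z \<in> ?B \<longleftrightarrow> - \<delta> \<le> Re z \<and> Re z \<le> 0 \<and> \<bar>Im z\<bar> \<le> R" for z
    by (auto simp: in_cbox_complex_iff)
  have "continuous_on ?B shifted_zeta"
    by (rule continuous_on_subset[OF cont]) (use \<delta> B in auto)
  then have "continuous_on ?B (\<lambda>z. (1 + z\<^sup>2 / of_real (R\<^sup>2)) / shifted_zeta z)"
    using R nz B by (intro continuous_intros) auto
  then have "bounded ((\<lambda>z. (1 + z\<^sup>2 / of_real (R\<^sup>2)) / shifted_zeta z) ` ?B)"
    by (intro compact_imp_bounded compact_continuous_image compact_cbox)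
  then obtain M where M: "M > 0" "\<forall>w\<in>(\<lambda>z. (1 + z\<^sup>2 / of_real (R\<^sup>2)) / shifted_zeta z) ` ?B. norm w \<le> M"
    unfolding bounded_pos by blast
  show ?thesis using \<delta> M nz B by (intro that[of \<delta> M]) auto
qed

lemma moebius_partial_tendsto_0: "(\<lambda>N. moebius_partial N 0) \<longlonglongrightarrow> 0"
proof (rule tendstoI)
  fix \<epsilon> :: real assume \<epsilon>: "\<epsilon> > 0"
  \<comment> \<open>The order of the choices matters: R fixes the arc terms at \<pi> \<epsilon>, and
    only then do \<delta> and M become available, as they depend on R.\<close>
  define R where "R = 4 / \<epsilon>"
  have R: "R > 0" using \<epsilon> by (simp add: R_def)
  obtain \<delta> M where \<delta>: "0 < \<delta>" "\<delta> < 1/2" and M: "M > 0"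
    and nz: "\<And>z. - \<delta> \<le> Re z \<Longrightarrow> \<bar>Im z\<bar> \<le> R \<Longrightarrow> shifted_zeta z \<noteq> 0"
    and bd: "\<And>z. - \<delta> \<le> Re z \<Longrightarrow> Re z \<le> 0 \<Longrightarrow> \<bar>Im z\<bar> \<le> R \<Longrightarrow>
      norm ((1 + z\<^sup>2 / of_real (R\<^sup>2)) / shifted_zeta z) \<le> M"
    using shifted_zeta_nonzero_box[OF R] by metis
  \<comment> \<open>Narrowing the rectangle keeps the same M, so \<eta> can make the horizontal
    sides contribute at most \<epsilon>/2. The remaining terms vanish as N grows.\<close>
  define \<eta> where "\<eta> = min \<delta> (\<epsilon> / (4 * M))"
  have \<eta>: "0 < \<eta>" "\<eta> \<le> \<delta>" "\<eta> \<le> \<epsilon> / (4 * M)" using \<delta> \<epsilon> M by (auto simp: \<eta>_def)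
  have M\<eta>: "2 * M * \<eta> \<le> \<epsilon> / 2" using \<eta>(3) M by (simp add: field_simps)
  have "(\<lambda>N::nat. 2 * pi / real N + 2 * R * M * real N powr (- \<eta>)) \<longlonglongrightarrow> 0 + 2 * R * M * 0"
    using \<eta> by (intro tendsto_intros lim_const_over_n tendsto_neg_powr filterlim_real_sequentially) auto
  then have "eventually (\<lambda>N::nat. 2 * pi / real N + 2 * R * M * real N powr (- \<eta>) < \<epsilon>) sequentially"
    using \<epsilon> by (intro order_tendstoD(2)[of _ 0]) auto
  then show "eventually (\<lambda>N. dist (moebius_partial N 0) 0 < \<epsilon>) sequentially"
    using eventually_ge_at_top[of 1]
  proof eventually_elim
    case (elim N)
    have "2 * pi * norm (moebius_partial N 0) \<le>
        4 * pi / R + 2 * pi / real N + 2 * M * \<eta> + 2 * R * M * real N powr (- \<eta>)"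
      using R \<eta> \<delta> elim nz bd by (intro newman_contour_bound) auto
    also have "4 * pi / R = pi * \<epsilon>" using \<epsilon> by (simp add: R_def)
    also have "pi * \<epsilon> + 2 * pi / real N + 2 * M * \<eta> + 2 * R * M * real N powr (- \<eta>) < pi * \<epsilon> + \<epsilon> / 2 + \<epsilon>"
      using elim(1) M\<eta> by linarith
    also have "\<dots> \<le> pi * \<epsilon> + pi * \<epsilon>"
      using pi_gt3 \<epsilon> mult_right_mono[of 3 pi \<epsilon>] by simp
    finally have "(2 * pi) * norm (moebius_partial N 0) < (2 * pi) * \<epsilon>" by simp
    then show ?case by simp
  qed
qed

theorem sum_moebius_mu_over_n_tendsto_0: "(\<lambda>X::nat. \<Sum>n=1..X. moebius_mu n / real n) \<longlonglongrightarrow> 0"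
proof -
  have eq: "moebius_partial N 0 = of_real (\<Sum>n=1..N. moebius_mu n / real n)" for N
    unfolding moebius_partial_def by (simp add: powr_minus divide_inverse)
  have "(\<lambda>N. complex_of_real (\<Sum>n=1..N. moebius_mu n / real n)) \<longlonglongrightarrow> complex_of_real 0"
    using moebius_partial_tendsto_0 unfolding eq of_real_0 .
  then show ?thesis by (rule iffD1[OF tendsto_of_real_iff])
qed

section \<open>Arbitrary sets of primes\<close>

lemma generated_by_UNIV: "generated_by UNIV = {1..}"
  by (auto simp: generated_by_def)

lemma sum_moebius_mu_all_divisors:
  assumes "n \<noteq> 0"
  shows "(\<Sum>d | d dvd n. moebius_mu d) = (if n = 1 then 1 else 0)"
proof -
  have "{d. d dvd n} = {d. d dvd n \<and> d \<in> generated_by UNIV}"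
    using assms by (auto simp: generated_by_UNIV intro!: Suc_leI gr0I)
  then show ?thesis
    using sum_moebius_mu_divisors[OF assms, of UNIV] assms
    by (simp add: prime_factorization_empty_iff)
qed

text \<open>The map d \<mapsto> n/d sends the divisors of n that are multiples of e onto the
  divisors of n/e, which leaves the ordinary Moebius divisor sum.\<close>

lemma sum_moebius_mu_codivisors:
  assumes n: "n \<noteq> 0" and e: "e dvd n"
  shows "(\<Sum>d | d dvd n \<and> e dvd d. moebius_mu (n div d)) = (if e = n then 1 else 0)"
proof -
  have e0: "e \<noteq> 0" using assms by auto
  have "(\<Sum>d | d dvd n \<and> e dvd d. moebius_mu (n div d)) = (\<Sum>k | k dvd n div e. moebius_mu k)"
  proof (rule sum.reindex_bij_witness[of _ "\<lambda>k. n div k" "\<lambda>d. n div d"])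
    fix k assume "k \<in> {k. k dvd n div e}"
    then obtain j where j: "n div e = k * j" by auto
    then have nk: "n = e * (k * j)" using e by (metis dvd_mult_div_cancel)
    have k0: "k \<noteq> 0" using nk n by auto
    have "n div k = e * j" using nk k0 by (simp add: mult.left_commute)
    then show "n div k \<in> {d. d dvd n \<and> e dvd d}" using nk by auto
    show "n div (n div k) = k" using nk n \<open>n div k = e * j\<close> by auto
  next
    fix d assume d: "d \<in> {d. d dvd n \<and> e dvd d}"
    then obtain i j where i: "n = d * i" and j: "d = e * j"
      unfolding dvd_def by blast
    then show "n div d \<in> {k. k dvd n div e}" using n e0 by (auto simp: mult.assoc)
    show "n div (n div d) = d" using i n by auto
  qed simp
  also have "\<dots> = (if e = n then 1 else 0)"
    using e n e0 by (subst sum_moebius_mu_all_divisors) auto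
  finally show ?thesis .
qed

text \<open>In terms of Dirichlet convolution this is
  \<open>\<mu> \<cdot> 1\<^bsub>\<langle>P\<rangle>\<^esub> = \<mu> * 1\<^bsub>\<langle>P'\<rangle>\<^esub>\<close>, where \<open>P'\<close> is the set of primes outside \<open>P\<close>.\<close>

lemma moebius_mu_generated_by_eq_convolution:
  assumes n: "n \<noteq> 0"
  shows "(\<Sum>d | d dvd n \<and> prime_factors d \<inter> P = {}. moebius_mu (n div d)) =
    (if n \<in> generated_by P then moebius_mu n else 0)"
proof -
  have fin: "finite {d. d dvd n}" using n by simp
  have "(\<Sum>d | d dvd n \<and> prime_factors d \<inter> P = {}. moebius_mu (n div d))
      = (\<Sum>d | d dvd n. (if prime_factors d \<inter> P = {} then 1 else 0) * moebius_mu (n div d))"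
    using fin by (intro sum.mono_neutral_cong_left) auto
  also have "\<dots> = (\<Sum>d | d dvd n. \<Sum>e | e \<in> {e. e dvd n \<and> e \<in> generated_by P} \<and> e dvd d.
      moebius_mu e * moebius_mu (n div d))"
  proof (intro sum.cong refl)
    fix d assume d: "d \<in> {d. d dvd n}"
    then have "d \<noteq> 0" using n by auto
    moreover have "{e. e dvd d \<and> e \<in> generated_by P} =
        {e. e \<in> {e. e dvd n \<and> e \<in> generated_by P} \<and> e dvd d}"
      using d by (auto intro: dvd_trans)
    ultimately show "(if prime_factors d \<inter> P = {} then 1 else 0) * moebius_mu (n div d) =
        (\<Sum>e | e \<in> {e. e dvd n \<and> e \<in> generated_by P} \<and> e dvd d. moebius_mu e * moebius_mu (n div d))"
      using sum_moebius_mu_divisors[of d P] by (simp flip: sum_distrib_right)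
  qed
  also have "\<dots> = (\<Sum>e | e dvd n \<and> e \<in> generated_by P. \<Sum>d | d \<in> {d. d dvd n} \<and> e dvd d.
      moebius_mu e * moebius_mu (n div d))"
    using fin by (intro sum.swap_restrict) auto
  also have "\<dots> = (\<Sum>e | e dvd n \<and> e \<in> generated_by P. if e = n then moebius_mu e else 0)"
    using n by (intro sum.cong refl)
      (auto simp: sum_moebius_mu_codivisors simp flip: sum_distrib_left)
  also have "\<dots> = (if n \<in> generated_by P then moebius_mu n else 0)"
    using fin by (subst sum.delta) auto
  finally show ?thesis .
qed

text \<open>The convolution formula is inserted and n is written as d m, with d free of primes from
  P. Each d then carries a full Moebius sum up to X div d.\<close>

lemma sum_moebius_mu_generated_by_eq:
  "(\<Sum>n\<in>generated_by P \<inter> {..X}. moebius_mu n / real n) =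
    (\<Sum>d | d \<in> {1..X} \<and> prime_factors d \<inter> P = {}. (1 / real d) * (\<Sum>m=1..X div d. moebius_mu m / real m))"
proof -
  have "(\<Sum>n\<in>generated_by P \<inter> {..X}. moebius_mu n / real n)
      = (\<Sum>n=1..X. (if n \<in> generated_by P then moebius_mu n else 0) / real n)"
    by (intro sum.mono_neutral_cong_left) (auto simp: generated_by_def)
  also have "\<dots> = (\<Sum>n=1..X. \<Sum>d | d \<in> {d\<in>{1..X}. prime_factors d \<inter> P = {}} \<and> d dvd n.
      moebius_mu (n div d) / real n)"
  proof (intro sum.cong refl)
    fix n assume n: "n \<in> {1..X}"
    have eq: "{d. d \<in> {d\<in>{1..X}. prime_factors d \<inter> P = {}} \<and> d dvd n}
        = {d. d dvd n \<and> prime_factors d \<inter> P = {}}"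
      using n by (auto dest: dvd_imp_le intro!: Suc_leI gr0I)
    show "(if n \<in> generated_by P then moebius_mu n else 0) / real n =
        (\<Sum>d | d \<in> {d\<in>{1..X}. prime_factors d \<inter> P = {}} \<and> d dvd n. moebius_mu (n div d) / real n)"
      unfolding eq using n moebius_mu_generated_by_eq_convolution[of n P]
      by (simp flip: sum_divide_distrib)
  qed
  also have "\<dots> = (\<Sum>d\<in>{d\<in>{1..X}. prime_factors d \<inter> P = {}}. \<Sum>n | n \<in> {1..X} \<and> d dvd n.
      moebius_mu (n div d) / real n)"
    by (rule sum.swap_restrict) auto
  also have "\<dots> = (\<Sum>d\<in>{d\<in>{1..X}. prime_factors d \<inter> P = {}}.
      (1 / real d) * (\<Sum>m=1..X div d. moebius_mu m / real m))"
  proof (intro sum.cong refl)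
    fix d assume "d \<in> {d\<in>{1..X}. prime_factors d \<inter> P = {}}"
    then have d: "d \<ge> 1" by simp
    have "{n. n \<in> {1..X} \<and> d dvd n} = (*) d ` {1..X div d}"
      using d by (auto simp: less_eq_div_iff_mult_less_eq algebra_simps Suc_le_eq)
    then have "(\<Sum>n | n \<in> {1..X} \<and> d dvd n. moebius_mu (n div d) / real n)
        = (\<Sum>m=1..X div d. moebius_mu m / real (d * m))"
      using d by (simp add: sum.reindex inj_on_def)
    then show "(\<Sum>n | n \<in> {1..X} \<and> d dvd n. moebius_mu (n div d) / real n) =
        (1 / real d) * (\<Sum>m=1..X div d. moebius_mu m / real m)"
      by (simp add: sum_distrib_left)
  qed
  finally show ?thesis by (simp add: Collect_conj_eq)
qed

lemma sum_moebius_mu_generated_by_tendsto_summable_complement: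
  assumes summ: "summable (\<lambda>p::nat. if prime p \<and> p \<notin> P then 1 / real p else 0)"
  shows "(\<lambda>X. \<Sum>n\<in>generated_by P \<inter> {..X}. moebius_mu n / real n) \<longlonglongrightarrow> 0"
proof -
  define M where "M X = (\<Sum>n=1..X. moebius_mu n / real n)" for X :: nat
  let ?Q = "{d. d \<ge> 1 \<and> prime_factors d \<inter> P = {}}"
  have M0: "M \<longlonglongrightarrow> 0" using sum_moebius_mu_over_n_tendsto_0 by (simp add: M_def[abs_def])
  then obtain C where C: "\<And>X. norm (M X) \<le> C"
    using convergent_imp_Bseq Bseq_def by (metis convergent_def)
  have Q: "?Q = generated_by {p. prime p \<and> p \<notin> P}"
    by (auto simp: generated_by_def in_prime_factors_iff)
  have "summable (\<lambda>d. if d \<in> generated_by {p. prime p \<and> p \<notin> P} then 1 / real d else 0)"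
    using summ by (intro summable_inverse_generated_by) auto
  then have summ': "summable (\<lambda>d. C * (if d \<in> ?Q then 1 / real d else 0))"
    unfolding Q by (rule summable_mult)
  define a where "a d X = (if d \<in> ?Q then (1 / real d) * M (X div d) else 0)" for d X
  have lim_a: "(\<lambda>X. a d X) \<longlonglongrightarrow> 0" for d
  proof (cases "d \<in> ?Q")
    case True
    have "filterlim (\<lambda>X. X div d) at_top sequentially"
      unfolding filterlim_at_top
    proof
      fix Z
      show "eventually (\<lambda>X. Z \<le> X div d) sequentially"
        using eventually_ge_at_top[of "Z * d"]
        by eventually_elim (use True in \<open>auto simp: less_eq_div_iff_mult_less_eq\<close>)
    qed
    with M0 have "(\<lambda>X. M (X div d)) \<longlonglongrightarrow> 0" by (rule filterlim_compose)
    from tendsto_mult_left[OF this, of "1 / real d"] show ?thesis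
      using True by (simp add: a_def)
  next
    case False
    then show ?thesis unfolding a_def by (simp only: if_False tendsto_const)
  qed
  have bnd: "norm (a d X) \<le> C * (if d \<in> ?Q then 1 / real d else 0)" for d X
    using C[of "X div d"] by (auto simp: a_def abs_mult divide_right_mono)
  have "eventually (\<lambda>(d, X). norm (a d X) \<le> C * (if d \<in> ?Q then 1 / real d else 0))
      (sequentially \<times>\<^sub>F sequentially)"
    using bnd by (intro always_eventually) auto
  from tannerys_theorem[OF lim_a this summ' sequentially_bot]
  have "(\<lambda>X. \<Sum>d. a d X) \<longlonglongrightarrow> (\<Sum>d::nat. 0)" by blast
  moreover have "(\<Sum>d. a d X) = (\<Sum>n\<in>generated_by P \<inter> {..X}. moebius_mu n / real n)" for X
  proof -
    \<comment> \<open>For d > X the quotient X div d is 0 and \<open>M 0\<close> is an empty sum, so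
      the series in Tannery's theorem is really finite.\<close>
    have "(\<Sum>d. a d X) = (\<Sum>d\<in>{d. d \<in> {1..X} \<and> prime_factors d \<inter> P = {}}. a d X)"
    proof (rule suminf_finite)
      fix d assume d: "d \<notin> {d. d \<in> {1..X} \<and> prime_factors d \<inter> P = {}}"
      show "a d X = 0"
      proof (cases "d > X")
        case True
        then show ?thesis by (simp add: a_def M_def)
      qed (use d in \<open>auto simp: a_def\<close>)
    qed auto
    also have "\<dots> = (\<Sum>d | d \<in> {1..X} \<and> prime_factors d \<inter> P = {}. (1 / real d) * M (X div d))"
      by (intro sum.cong) (auto simp: a_def)
    finally show ?thesis unfolding sum_moebius_mu_generated_by_eq M_def .
  qed
  ultimately show ?thesis by simp
qed

text \<open>In Legendre's identity the rounding error is at most 1 for each element of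
  \<open>generated_by P\<close>. These elements avoid all primes outside P, so the error count has
  density 0 by \<open>div'\<close>, as the main count has by \<open>div\<close>.\<close>

lemma sum_moebius_mu_generated_by_tendsto_both_divergent:
  assumes P: "\<And>p. p \<in> P \<Longrightarrow> prime p"
    and div: "\<not> summable (\<lambda>p::nat. if p \<in> P then 1 / real p else 0)"
    and div': "\<not> summable (\<lambda>p::nat. if prime p \<and> p \<notin> P then 1 / real p else 0)"
  shows "(\<lambda>X. \<Sum>n\<in>generated_by P \<inter> {..X}. moebius_mu n / real n) \<longlonglongrightarrow> 0"
proof (rule tendsto_0_le[where K = 1])
  let ?N = "\<lambda>X. card {n\<in>{1..X}. prime_factors n \<inter> P = {}}"
  let ?N' = "\<lambda>X. card {n\<in>{1..X}. prime_factors n \<inter> {p. prime p \<and> p \<notin> P} = {}}"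
  have "(\<lambda>X. real (?N X) / real X) \<longlonglongrightarrow> 0"
    using div P by (rule avoiding_primes_density_0)
  moreover have "(\<lambda>X. real (?N' X) / real X) \<longlonglongrightarrow> 0"
    using div' by (intro avoiding_primes_density_0) auto
  ultimately show "(\<lambda>X. real (?N X) / real X + real (?N' X) / real X) \<longlonglongrightarrow> 0"
    by (rule tendsto_add_zero)
  show "eventually (\<lambda>X. norm (\<Sum>n\<in>generated_by P \<inter> {..X}. moebius_mu n / real n)
      \<le> norm (real (?N X) / real X + real (?N' X) / real X) * 1) sequentially"
    using eventually_gt_at_top[of 0]
  proof eventually_elim
    case (elim X)
    let ?G = "{1..X} \<inter> generated_by P" and ?S = "\<Sum>n\<in>generated_by P \<inter> {..X}. moebius_mu n / real n"
    have G: "generated_by P \<inter> {..X} = ?G" by (auto simp: generated_by_def)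
    have card_G: "card ?G \<le> ?N' X"
      by (intro card_mono) (auto simp: generated_by_def)
    have "\<bar>real X * ?S - real (?N X)\<bar> = \<bar>\<Sum>d\<in>?G. moebius_mu d * (real X / real d - real (X div d))\<bar>"
      unfolding card_avoiding_primes G
      by (simp add: sum_distrib_left sum_subtractf algebra_simps)
    also have "\<dots> \<le> (\<Sum>d\<in>?G. \<bar>moebius_mu d * (real X / real d - real (X div d))\<bar>)"
      by (rule sum_abs)
    also have "\<dots> \<le> (\<Sum>d\<in>?G. 1 * 1)"
    proof (rule sum_mono)
      fix d assume "d \<in> ?G"
      have "\<bar>real X / real d - real (X div d)\<bar> \<le> 1"
        using floor_correct[of "real X / real d"] unfolding floor_divide_of_nat_eq by simp
      then show "\<bar>moebius_mu d * (real X / real d - real (X div d))\<bar> \<le> 1 * 1"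
        unfolding abs_mult using abs_moebius_mu_le[of d] by (intro mult_mono) auto
    qed
    also have "\<dots> \<le> real (?N' X)" using card_G by simp
    finally have "\<bar>real X * ?S\<bar> \<le> real (?N X) + real (?N' X)" by linarith
    then have "real X * \<bar>?S\<bar> \<le> real (?N X) + real (?N' X)" by (simp add: abs_mult)
    then have "\<bar>?S\<bar> \<le> real (?N X) / real X + real (?N' X) / real X"
      using elim by (simp add: field_simps)
    then show ?case by simp
  qed
qed

lemma moebius_mu_generated_by_limits:
  assumes primes: "\<forall>p\<in>P. prime p"
  shows "\<exists>L::real.
    (\<lambda>X. \<Prod>p\<in>P \<inter> {..X}. 1 - 1 / real p) \<longlonglongrightarrow> L \<and>
    (\<lambda>X. \<Sum>n\<in>generated_by P \<inter> {..X}. moebius_mu n / real n) \<longlonglongrightarrow> L \<and>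
    (L = 0 \<longleftrightarrow> \<not> summable (\<lambda>p::nat. if p \<in> P then 1 / real p else 0))"
proof (cases "summable (\<lambda>p::nat. if p \<in> P then 1 / real p else 0)")
  case True
  have P: "\<And>p. p \<in> P \<Longrightarrow> prime p" using primes by blast
  define K where "K = (\<Sum>p. if p \<in> P then 1 / real p else 0)"
  define a where "a n = (if n \<in> generated_by P then of_real (moebius_mu n) * (1 / real n) else 0)" for n
  have "summable (\<lambda>n. if n \<in> generated_by P then 1 / real n else 0)"
    using True P by (rule summable_inverse_generated_by)
  then have "summable (\<lambda>n. if n \<in> generated_by P then norm (1 / real n) else 0)"
    by (simp cong: if_cong)
  note euler = moebius_mu_euler_product[OF P _ _ this, folded a_def]
  have prod: "(\<lambda>X. \<Prod>p\<in>P \<inter> {..X}. 1 - 1 / real p) \<longlonglongrightarrow> suminf a"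
    by (rule euler) auto
  have "summable (\<lambda>n. norm (a n))" by (rule euler) auto
  then have "a sums suminf a" by (intro summable_sums) (rule summable_norm_cancel)
  then have "(\<lambda>X. \<Sum>n\<le>X. a n) \<longlonglongrightarrow> suminf a" by (simp add: sums_def_le)
  moreover have "(\<Sum>n\<le>X. a n) = (\<Sum>n\<in>generated_by P \<inter> {..X}. moebius_mu n / real n)" for X
    by (intro sum.mono_neutral_cong_right) (auto simp: a_def)
  ultimately have sum: "(\<lambda>X. \<Sum>n\<in>generated_by P \<inter> {..X}. moebius_mu n / real n) \<longlonglongrightarrow> suminf a"
    by simp
  \<comment> \<open>A lower bound uniform in X survives the limit; this is why the limit is nonzero
    in the summable case.\<close>
  have "exp (- 2 * K) \<le> suminf a"
  proof (rule tendsto_lowerbound[OF prod _ sequentially_bot])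
    have "exp (- 2 * K) \<le> (\<Prod>p\<in>P \<inter> {..X}. 1 - 1 / real p)" for X
    proof -
      have "exp (- 2 * K) \<le> exp (- 2 * (\<Sum>p\<in>P \<inter> {..X}. 1 / real p))"
        using sum_inverse_le_suminf[OF True, of "P \<inter> {..X}"] by (simp add: K_def)
      also have "\<dots> \<le> (\<Prod>p\<in>P \<inter> {..X}. 1 - 1 / real p)"
        using P by (intro prod_one_minus_inverse_ge_exp) auto
      finally show ?thesis .
    qed
    then show "eventually (\<lambda>X. exp (- 2 * K) \<le> (\<Prod>p\<in>P \<inter> {..X}. 1 - 1 / real p)) sequentially"
      by simp
  qed
  moreover have "exp (- 2 * K) > 0" by simp
  ultimately have "suminf a \<noteq> 0" by linarith
  with prod sum True show ?thesis by blast
next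
  case False
  have P: "\<And>p. p \<in> P \<Longrightarrow> prime p" using primes by blast
  have "(\<lambda>X. \<Sum>n\<in>generated_by P \<inter> {..X}. moebius_mu n / real n) \<longlonglongrightarrow> 0"
    using sum_moebius_mu_generated_by_tendsto_summable_complement[of P]
      sum_moebius_mu_generated_by_tendsto_both_divergent[OF P False] by blast
  moreover have "(\<lambda>X. \<Prod>p\<in>P \<inter> {..X}. 1 - 1 / real p) \<longlonglongrightarrow> 0"
    using False P by (rule prod_one_minus_inverse_tendsto_0)
  ultimately show ?thesis using False by blast
qed

theorem theorem1p2:
  fixes P :: "nat set"
  assumes "\<forall>p\<in>P. prime p"
  shows "\<exists>L::real.
     ((\<lambda>x::real. \<Prod>p\<in>{p\<in>P. real p \<le> x}. (1 - 1 / real p)) \<longlongrightarrow> L) at_top \<and>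
     ((\<lambda>x::real. \<Sum>n\<in>{n\<in>generated_by P. real n \<le> x}. moebius_mu n / real n) \<longlongrightarrow> L) at_top \<and>
     (L = 0 \<longleftrightarrow> \<not> summable (\<lambda>p::nat. if p \<in> P then 1 / real p else 0))"
proof -
  obtain L :: real where L: "(\<lambda>X. \<Prod>p\<in>P \<inter> {..X}. 1 - 1 / real p) \<longlonglongrightarrow> L"
    "(\<lambda>X. \<Sum>n\<in>generated_by P \<inter> {..X}. moebius_mu n / real n) \<longlonglongrightarrow> L"
    "L = 0 \<longleftrightarrow> \<not> summable (\<lambda>p::nat. if p \<in> P then 1 / real p else 0)"
    using moebius_mu_generated_by_limits[OF assms]
    by (elim exE conjE) (erule (2) that)
  have floor: "filterlim (\<lambda>x::real. nat \<lfloor>x\<rfloor>) at_top at_top"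
    by (intro filterlim_compose[OF filterlim_nat_sequentially] filterlim_floor_sequentially)
  have set: "{n\<in>A. real n \<le> x} = A \<inter> {..nat \<lfloor>x\<rfloor>}" if "x \<ge> 0" for A and x :: real
    using that by (auto simp: le_nat_iff le_floor_iff)
  \<comment> \<open>For x \<ge> 0 the index sets depend on x only through its integer part, so
    limits along the naturals carry over. \<open>F\<close> stands for both the product and the
    sum.\<close>
  have transfer: "((\<lambda>x::real. F {n\<in>A. real n \<le> x}) \<longlongrightarrow> L) at_top"
    if "(\<lambda>X. F (A \<inter> {..X})) \<longlonglongrightarrow> L" for A and F :: "nat set \<Rightarrow> real"
  proof (rule Lim_transform_eventually)
    show "((\<lambda>x::real. F (A \<inter> {..nat \<lfloor>x\<rfloor>})) \<longlongrightarrow> L) at_top"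
      using that floor by (rule filterlim_compose)
    show "eventually (\<lambda>x::real. F (A \<inter> {..nat \<lfloor>x\<rfloor>}) = F {n\<in>A. real n \<le> x}) at_top"
      using eventually_ge_at_top[of 0] by eventually_elim (simp add: set)
  qed
  show ?thesis
    using transfer[of "prod (\<lambda>p. 1 - 1 / real p)", OF L(1)]
      transfer[of "sum (\<lambda>n. moebius_mu n / real n)", OF L(2)] L(3)
    by (intro exI[of _ L] conjI)
qed

end
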